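(* Let $q$ be a prime power. For all integers $2\le r\le n$, we have $$\log(m_q(r,n)+1)\leq \frac{1}{[n-r+1]_q}\begin{bmatrix} n\\ r\end{bmatrix}_q\log\bigl(e[n-r+1]_q\bigr)\,\bigl(1+ \epsilon(r,n)\bigr),$$ where $$\epsilon(r,n):=\frac{[2]_q\,\log(n-r+2)}{[n-r+2]_q\,\log(e[n-r+1]_q)}.$$
   Context: For a prime power $q$ and $k\in\mathbb N$, $[k]_q=\frac{q^k-1}{q-1}$, and $\begin{bmatrix} n\\ k\end{bmatrix}_q$ is the Gaussian binomial coefficient, i.e. the number of $k$-dimensional subspaces of $\mathbb F_q^n$. The logarithm is to any fixed base greater than $1$, and $e$ is Euler's number. For a finite-dimensional vector space $E$ over $\mathbb F_q$, let $\mathcal L(E)$ denote the set of all linear subspaces of $E$. A $q$-matroid is a pair $M=(E,\rho)$ with $\rho:\mathcal L(E)\to\mathbb Z_{\ge 0}$ such that for all $V,W\in\mathcal L(E)$: (R1) $0\le\rho(V)\le\dim V$; (R2) $V\le W$ implies $\rho(V)\le\rho(W)$; (R3) $\rho(V+W)+\rho(V\cap W)\le\rho(V)+\rho(W)$. $E$ is the ground space and $\rho(E)$ the rank of $M$. $m_q(r,n)$ denotes the number of $q$-matroids with ground space $\mathbb F_q^n$ and rank $r$ (counted as distinct whenever they are not equal, i.e. not up to isomorphism). *)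

theory Defs
  imports "HOL-Analysis.Cartesian_Space"
begin

definition subspaces_of :: "('a::{field,finite}^'n) set \<Rightarrow> ('a^'n) set set" where
  "subspaces_of E = {V. vec.subspace V \<and> V \<subseteq> E}"

text \<open>
  The ground space may be any subspace of \<open>'a^'n\<close>, so every finite-dimensional space over the
  field occurs up to isomorphism.  Rank functions are extensional (\<open>undefined\<close> off
  \<^term>\<open>subspaces_of E\<close>), so that two q-matroids on \<open>E\<close> are equal in HOL exactly
  when they agree on all subspaces of \<open>E\<close>.
\<close>

definition q_matroid :: "('a::{field,finite}^'n) set \<Rightarrow> (('a^'n) set \<Rightarrow> nat) \<Rightarrow> bool" where
  "q_matroid E \<rho> \<longleftrightarrow>
     vec.subspace E \<and>
     \<rho> \<in> extensional (subspaces_of E) \<and>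
     (\<forall>V\<in>subspaces_of E. 0 \<le> \<rho> V \<and> \<rho> V \<le> vec.dim V) \<and>
     (\<forall>V\<in>subspaces_of E. \<forall>W\<in>subspaces_of E. V \<subseteq> W \<longrightarrow> \<rho> V \<le> \<rho> W) \<and>
     (\<forall>V\<in>subspaces_of E. \<forall>W\<in>subspaces_of E.
        \<rho> {v + w | v w. v \<in> V \<and> w \<in> W} + \<rho> (V \<inter> W) \<le> \<rho> V + \<rho> W)"

definition num_q_matroids :: "('a::{field,finite}^'n) set \<Rightarrow> nat \<Rightarrow> nat" where
  "num_q_matroids E r = card {\<rho>. q_matroid E \<rho> \<and> \<rho> E = r}"

definition q_bracket :: "nat \<Rightarrow> nat \<Rightarrow> real" where
  "q_bracket q k = (real q ^ k - 1) / (real q - 1)"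

text \<open>For \<open>E\<close> the whole space \<open>'a^'n\<close> this is the Gaussian binomial coefficient with
  upper index \<open>CARD('n)\<close>, lower index \<open>k\<close> and base \<open>CARD('a)\<close>.\<close>

definition gaussian_binomial :: "('a::{field,finite}^'n) set \<Rightarrow> nat \<Rightarrow> nat" where
  "gaussian_binomial E k = card {V \<in> subspaces_of E. vec.dim V = k}"

definition q_eps :: "real \<Rightarrow> nat \<Rightarrow> nat \<Rightarrow> nat \<Rightarrow> real" where
  "q_eps b q r n =
     (q_bracket q 2 * log b (real (n - r + 2))) /
     (q_bracket q (n - r + 2) * log b (exp 1 * q_bracket q (n - r + 1)))"

end

(*
  A q-matroid of rank r is determined by its set of bases, and these sets together with the empty
  set form a family F of sets of r-spaces.  For an (r-2)-space T, the trace of F on the r-spaces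
  above T has at most N + 1 members: it is empty when T is dependent, and otherwise it is read off
  the rank-two contraction by T, which lives on a complement of T of dimension m = n - r + 2; here
  N is the number of rank-two q-matroids on such a space.  Shearer's inequality and double counting
  give log(m_q(r,n) + 1) / [n r]_q <= log(N + 1) / [m 2]_q.

  For N, a rank-two q-matroid without loops partitions the nonzero vectors into the nonzero vectors
  of its rank-one flats.  In a flat of dimension d, d - 1 lines through one common vector span the
  flat, and d - 1 <= [d]_q / [2]_q, so the q-matroid is encoded by at most [m]_q / [2]_q lines;
  this leaves at most (e [m-1]_q) powr ([m]_q / [2]_q) possibilities.  Contracting a loop reduces
  the remaining q-matroids to dimension m - 1, whence N + 1 <= m (e [m-1]_q) powr ([m]_q / [2]_q).
*)
theory Submission
  imports Defs "HOL-Analysis.Convex"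
begin

text \<open>Quotient spaces do not exist inside \<open>'a^'n\<close>, so a contraction by
  \<open>T\<close> is placed on a chosen complement of \<open>T\<close>. Complements are not unique;
  therefore all counts are made for arbitrary subspaces of the fixed space, with bounds that depend
  only on the dimension. The constants come from counting codes. An m-space has [m]_q [m-1]_q /
  [2]_q lines, and a code is a set of at most k = [m]_q / [2]_q of them; the bound (e A / k) powr k
  for small subsets of an A-set then has base e [m-1]_q. Dividing the logarithm of the rank-two
  bound by the number of lines gives log(e [m-1]_q) / [m-1]_q as main term, and the remaining factor
  m is the sole source of epsilon(r,n). Loops are the obstacle to using codes directly. Choosing a
  loop costs a factor [m]_q, but this times the code bound in dimension m - 1 is at most the code
  bound in dimension m, so each dimension adds just one more copy of the bound.\<close>

definition subspace_sum ::
    "('a::{field,finite}^'n) set \<Rightarrow> ('a^'n) set \<Rightarrow> ('a^'n) set" (infixl "\<oplus>" 65) where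
  "V \<oplus> W = {v + w | v w. v \<in> V \<and> w \<in> W}"

subsection \<open>Subspaces over a finite field\<close>

text \<open>Dimension facts below are stated for spans; rewriting
  \<open>vec.dim (vec.span B)\<close> to \<open>vec.dim B\<close> would remove the terms they
  match.\<close>

declare vec.dim_span [simp del]

lemma sumI: "v \<in> V \<Longrightarrow> w \<in> W \<Longrightarrow> v + w \<in> V \<oplus> W"
  by (auto simp: subspace_sum_def)

lemma sumE:
  assumes "x \<in> V \<oplus> W"
  obtains v w where "x = v + w" "v \<in> V" "w \<in> W"
  using assms by (auto simp: subspace_sum_def)

lemma subspace_sum: "vec.subspace V \<Longrightarrow> vec.subspace W \<Longrightarrow> vec.subspace (V \<oplus> W)"
  unfolding subspace_sum_def by (rule vec.subspace_sums)

lemma dim_sum_Int: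
  "vec.subspace V \<Longrightarrow> vec.subspace W \<Longrightarrow>
    vec.dim (V \<oplus> W) + vec.dim (V \<inter> W) = vec.dim V + vec.dim W"
  unfolding subspace_sum_def by (rule vec.dim_sums_Int)

lemma subspaces_ofI: "vec.subspace V \<Longrightarrow> V \<subseteq> E \<Longrightarrow> V \<in> subspaces_of E"
  by (simp add: subspaces_of_def)

lemma subspaces_ofD:
  assumes "V \<in> subspaces_of E"
  shows "vec.subspace V" "V \<subseteq> E"
  using assms by (simp_all add: subspaces_of_def)

lemma subspaces_of_self: "vec.subspace E \<Longrightarrow> E \<in> subspaces_of E"
  by (simp add: subspaces_of_def)

lemma subspaces_of_zero: "vec.subspace E \<Longrightarrow> {0} \<in> subspaces_of E"
  by (simp add: subspaces_of_def vec.subspace_0 vec.subspace_single_0)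

lemma subspaces_of_Int:
  "V \<in> subspaces_of E \<Longrightarrow> W \<in> subspaces_of E \<Longrightarrow> V \<inter> W \<in> subspaces_of E"
  by (auto simp: subspaces_of_def vec.subspace_inter)

lemma sum_least:
  assumes "vec.subspace U" "V \<subseteq> U" "W \<subseteq> U"
  shows "V \<oplus> W \<subseteq> U"
  using assms by (auto intro!: vec.subspace_add elim!: sumE)

lemma subspaces_of_sum:
  assumes "vec.subspace E" "V \<in> subspaces_of E" "W \<in> subspaces_of E"
  shows "V \<oplus> W \<in> subspaces_of E"
  using assms sum_least[of E V W] subspace_sum[of V W] by (simp add: subspaces_of_def)

lemma sum_upper1: "vec.subspace W \<Longrightarrow> V \<subseteq> V \<oplus> W"
  using sumI[of _ V 0 W] vec.subspace_0 by force

lemma sum_upper2: "vec.subspace V \<Longrightarrow> W \<subseteq> V \<oplus> W"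
  using sumI[of 0 V _ W] vec.subspace_0 by force

lemma subspace_sum_mono: "V \<subseteq> V' \<Longrightarrow> W \<subseteq> W' \<Longrightarrow> V \<oplus> W \<subseteq> V' \<oplus> W'"
  by (auto simp: subspace_sum_def)

text \<open>Dedekind's law: if \<open>x = c + t\<close> lies in \<open>V\<close>, so does
  \<open>c = x - t\<close>, because \<open>T \<subseteq> V\<close>. For a complement
  \<open>C\<close> of \<open>T\<close> it lets \<open>V \<inter> C\<close> play the role of the
  quotient of \<open>V\<close> by \<open>T\<close>.\<close>

lemma modular_law:
  assumes "vec.subspace V" "T \<subseteq> V"
  shows "(V \<inter> C) \<oplus> T = V \<inter> (C \<oplus> T)"
proof
  show "(V \<inter> C) \<oplus> T \<subseteq> V \<inter> (C \<oplus> T)"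
    using assms by (auto intro!: vec.subspace_add sumI elim!: sumE)
  show "V \<inter> (C \<oplus> T) \<subseteq> (V \<inter> C) \<oplus> T"
  proof
    fix x assume "x \<in> V \<inter> (C \<oplus> T)"
    then obtain c t where *: "x = c + t" "c \<in> C" "t \<in> T" "x \<in> V" by (auto elim: sumE)
    then have "c = x - t" "t \<in> V" using assms by auto
    then have "c \<in> V" using * assms vec.subspace_diff by blast
    with * show "x \<in> (V \<inter> C) \<oplus> T" by (auto intro: sumI)
  qed
qed

lemma dim_zero: "vec.dim {0} = 0"
  by simp

lemma dim_sum:
  assumes "vec.subspace V" "vec.subspace W" "V \<inter> W = {0}"
  shows "vec.dim (V \<oplus> W) = vec.dim V + vec.dim W"
  using dim_sum_Int[of V W] assms vec.dim_eq_0[of "{0}"] by simp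

text \<open>A basis of \<open>T\<close> is extended to one of \<open>E\<close>, and the added
  vectors span \<open>C\<close>.\<close>

lemma complement_exists:
  assumes "vec.subspace T" "vec.subspace E" "T \<subseteq> E"
  obtains C where "C \<in> subspaces_of E" "C \<inter> T = {0}" "C \<oplus> T = E"
    "vec.dim E = vec.dim C + vec.dim T"
proof -
  obtain A where A: "A \<subseteq> T" "vec.independent A" "T \<subseteq> vec.span A"
    using vec.basis_exists[of T] by metis
  obtain B where B: "A \<subseteq> B" "B \<subseteq> E" "vec.independent B" "E \<subseteq> vec.span B"
    using vec.maximal_independent_subset_extend[of A E] A(1,2) assms(3) by (metis order_trans)
  define C where "C = vec.span (B - A)"
  have T: "T = vec.span A" using subset_antisym[OF A(3) vec.span_minimal[OF A(1) assms(1)]] .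
  have E: "E = vec.span B" using subset_antisym[OF B(4) vec.span_minimal[OF B(2) assms(2)]] .
  have fin: "finite A" "finite B" by simp_all
  have sum: "C \<oplus> T = E"
    unfolding C_def T E subspace_sum_def using vec.span_Un[of "B - A" A] B(1)
    by (simp add: Un_absorb2)
  have dC: "vec.dim C = card (B - A)"
    unfolding C_def using B by (metis Diff_subset vec.dim_span_eq_card_independent vec.independent_mono)
  have dE: "vec.dim E = card B" and dT: "vec.dim T = card A"
    unfolding E T using B A by (simp_all add: vec.dim_span_eq_card_independent)
  have d: "vec.dim E = vec.dim C + vec.dim T"
    using dC dE dT B(1) fin by (simp add: card_Diff_subset card_mono)
  have sC: "vec.subspace C" by (simp add: C_def)
  have "vec.dim (C \<inter> T) = 0"
    using dim_sum_Int[OF sC assms(1)] sum d by simp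
  then have "C \<inter> T \<subseteq> {0}" by simp
  then have "C \<inter> T = {0}" using sC assms(1) vec.subspace_0 by blast
  moreover have "C \<in> subspaces_of E"
    using sC sum sum_upper1[of T C] assms(1) by (auto intro!: subspaces_ofI)
  ultimately show ?thesis using that sum d by blast
qed

lemma subspace_of_dim_exists:
  assumes "d \<le> vec.dim E" "vec.subspace E"
  obtains V where "V \<in> subspaces_of E" "vec.dim V = d"
proof -
  obtain B where B: "B \<subseteq> E" "vec.independent B" "card B = vec.dim E"
    using vec.basis_exists[of E] by metis
  obtain A where A: "A \<subseteq> B" "card A = d" using obtain_subset_with_card_n[of d B] B(3) assms(1) by metis
  have "vec.span A \<in> subspaces_of E"
    using A(1) B(1) assms(2) by (simp add: subspaces_of_def vec.span_minimal)
  moreover have "vec.dim (vec.span A) = d"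
    using vec.dim_span_eq_card_independent[of A] vec.independent_mono[OF B(2) A(1)] A(2) by simp
  ultimately show ?thesis using that by blast
qed

text \<open>A linear isomorphism maps subspaces injectively to subspaces of equal dimension, and
  \<open>V\<close> and \<open>W\<close> may be exchanged. This makes the covering multiplicity in
  Shearer's inequality the same for all r-spaces.\<close>

lemma card_subspaces_of_dim_cong:
  fixes V W :: "('a::{field,finite}^'n) set"
  assumes "vec.subspace V" "vec.subspace W" "vec.dim V = vec.dim W"
  shows "card {T \<in> subspaces_of V. vec.dim T = k} = card {T \<in> subspaces_of W. vec.dim T = k}"
proof -
  have le: "card {T \<in> subspaces_of V. vec.dim T = k} \<le> card {T \<in> subspaces_of W. vec.dim T = k}"
    if "vec.subspace V" "vec.subspace W" "vec.dim V = vec.dim W" for V W :: "('a^'n) set"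
  proof -
    obtain f where f: "Vector_Spaces.linear (*s) (*s) f" "f ` V = W" "inj_on f V"
      using vec.subspace_isomorphism[of V W] \<open>vec.subspace V\<close> \<open>vec.subspace W\<close> \<open>vec.dim V = vec.dim W\<close>
      by blast
    show ?thesis
    proof (rule card_inj_on_le[where f = "(`) f"])
      show "inj_on ((`) f) {T \<in> subspaces_of V. vec.dim T = k}"
        by (rule inj_on_subset[OF inj_on_image_Pow[OF f(3)]]) (auto simp: subspaces_of_def)
      show "(`) f ` {T \<in> subspaces_of V. vec.dim T = k} \<subseteq> {T \<in> subspaces_of W. vec.dim T = k}"
      proof clarify
        fix T assume T: "T \<in> subspaces_of V"
        then have sT: "vec.subspace T" "T \<subseteq> V" by (simp_all add: subspaces_of_def)
        then have "vec.subspace (f ` T)" using f(1) vec.linear_subspace_image by blast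
        moreover have "vec.dim (f ` T) = vec.dim T"
          using vec.dim_image_eq[OF f(1)] sT inj_on_subset[OF f(3)] by (metis vec.span_eq_iff)
        ultimately show "f ` T \<in> subspaces_of W \<and> vec.dim (f ` T) = vec.dim T"
          using sT f(2) by (auto simp: subspaces_of_def)
      qed
    qed simp
  qed
  show ?thesis using le[of V W] le[of W V] assms by simp
qed

section \<open>Numbers of vectors, points and lines\<close>

lemma card_field_ge_2: "CARD('a::{field,finite}) \<ge> 2"
proof -
  have "card {0, 1 :: 'a} \<le> CARD('a)" by (rule card_mono) simp_all
  then show ?thesis by simp
qed

text \<open>Each vector of the larger span is \<open>k *s x + y\<close> for exactly one scalar
  \<open>k\<close> and one \<open>y\<close> in the old span.\<close>

lemma card_span_independent:
  fixes B :: "('a::{field,finite}^'n) set"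
  assumes "vec.independent B"
  shows "card (vec.span B) = CARD('a) ^ card B"
  using finite[of B] assms
proof (induction B rule: finite_induct)
  case (insert x B)
  have ind: "vec.independent B" "x \<notin> vec.span B"
    using insert.prems insert.hyps vec.independent_insert[of x B] by auto
  have "vec.span (insert x B) = (\<lambda>(k, y). k *s x + y) ` (UNIV \<times> vec.span B)"
  proof (intro set_eqI iffI)
    fix z assume "z \<in> vec.span (insert x B)"
    then obtain k where "z - k *s x \<in> vec.span B" using vec.span_breakdown_eq by blast
    then show "z \<in> (\<lambda>(k, y). k *s x + y) ` (UNIV \<times> vec.span B)"
      by (intro image_eqI[of _ _ "(k, z - k *s x)"]) auto
  next
    fix z assume "z \<in> (\<lambda>(k, y). k *s x + y) ` (UNIV \<times> vec.span B)"
    then obtain k y where "z = k *s x + y" "y \<in> vec.span B" by auto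
    then show "z \<in> vec.span (insert x B)"
      unfolding vec.span_breakdown_eq by (intro exI[of _ k]) simp
  qed
  moreover have "inj_on (\<lambda>(k, y). k *s x + y) (UNIV \<times> vec.span B)"
  proof (rule inj_onI, clarify)
    fix k y k' y'
    assume y: "y \<in> vec.span B" "y' \<in> vec.span B" and eq: "k *s x + y = k' *s x + y'"
    have "(k - k') *s x = y' - y" using eq by (simp add: vec.scale_left_diff_distrib algebra_simps)
    then have *: "(k - k') *s x \<in> vec.span B" using y vec.span_diff by simp
    have "k = k'"
    proof (rule ccontr)
      assume "k \<noteq> k'"
      then have "x = inverse (k - k') *s ((k - k') *s x)" by simp
      then show False using * ind(2) vec.span_scale by metis
    qed
    with eq show "k = k' \<and> y = y'" by simp
  qed
  ultimately have "card (vec.span (insert x B)) = CARD('a) * card (vec.span B)"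
    by (simp add: card_image card_cartesian_product)
  then show ?case using insert.IH[OF ind(1)] insert.hyps by simp
qed simp

lemma card_subspace:
  fixes V :: "('a::{field,finite}^'n) set"
  assumes "vec.subspace V"
  shows "card V = CARD('a) ^ vec.dim V"
proof -
  obtain B where B: "B \<subseteq> V" "vec.independent B" "V \<subseteq> vec.span B" "card B = vec.dim V"
    using vec.basis_exists[of V] by metis
  then have "V = vec.span B" using vec.span_minimal[of B V] assms by simp
  then show ?thesis using card_span_independent[of B] B by simp
qed

lemma span_singleton_in: "x \<in> E \<Longrightarrow> vec.subspace E \<Longrightarrow> vec.span {x} \<in> subspaces_of E"
  by (simp add: subspaces_of_def vec.span_minimal)

lemma dim_span_singleton: "x \<noteq> 0 \<Longrightarrow> vec.dim (vec.span {x}) = 1"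
  using vec.dim_span_eq_card_independent[of "{x}"] by simp

lemma span_pair_in:
  "x \<in> E \<Longrightarrow> y \<in> E \<Longrightarrow> vec.subspace E \<Longrightarrow> vec.span {x, y} \<in> subspaces_of E"
  by (simp add: subspaces_of_def vec.span_minimal)

lemma dim_span_pair:
  assumes "x \<noteq> 0" "y \<notin> vec.span {x}"
  shows "vec.dim (vec.span {x, y}) = 2"
proof -
  have "y \<noteq> x" using assms vec.span_base[of x "{x}"] by blast
  moreover have "vec.independent {y, x}"
    using assms vec.independent_insert[of y "{x}"] \<open>y \<noteq> x\<close> by simp
  ultimately have "vec.dim (vec.span {y, x}) = 2" using vec.dim_span_eq_card_independent[of "{y, x}"] by simp
  then show ?thesis by (simp add: insert_commute)
qed

lemma span_eq_subspace:
  assumes "B \<subseteq> U" "vec.subspace U" "vec.dim (vec.span B) = vec.dim U"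
  shows "vec.span B = U"
  by (rule vec.subspace_dim_equal) (use assms in \<open>simp_all add: vec.span_minimal\<close>)

text \<open>The points partition the nonzero vectors of \<open>E\<close> into sets of size
  \<open>CARD('a) - 1\<close>.\<close>

lemma card_points:
  fixes E :: "('a::{field,finite}^'n) set"
  assumes "vec.subspace E"
  shows "card {p \<in> subspaces_of E. vec.dim p = 1} * (CARD('a) - 1) = CARD('a) ^ vec.dim E - 1"
proof -
  let ?P = "{p \<in> subspaces_of E. vec.dim p = 1}"
  have "card (E - {0}) = (\<Sum>p\<in>?P. card (p - {0}))"
  proof -
    have "\<exists>p\<in>?P. x \<in> p" if "x \<in> E - {0}" for x
      using that span_singleton_in[OF _ assms, of x] dim_span_singleton[of x]
      by (intro bexI[of _ "vec.span {x}"]) (simp_all add: vec.span_base)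
    then have "E - {0} = (\<Union>p\<in>?P. p - {0})"
      by (fastforce simp: subspaces_of_def)
    moreover have "card (\<Union>p\<in>?P. p - {0}) = (\<Sum>p\<in>?P. card (p - {0}))"
    proof (rule card_UN_disjoint; (intro ballI impI)?)
      fix p p' assume pp: "p \<in> ?P" "p' \<in> ?P" "p \<noteq> p'"
      have "vec.span {x} = p" if "x \<in> p" "x \<noteq> 0" "p \<in> ?P" for x p
        using that span_eq_subspace[of "{x}" p] by (simp add: dim_span_singleton subspaces_of_def)
      then show "(p - {0}) \<inter> (p' - {0}) = {}" using pp by blast
    qed simp_all
    ultimately show ?thesis by simp
  qed
  also have "\<dots> = (\<Sum>p\<in>?P. CARD('a) - 1)"
    by (rule sum.cong) (auto simp: subspaces_of_def card_subspace card_Diff_singleton vec.subspace_0)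
  finally show ?thesis
    using assms by (simp add: card_subspace card_Diff_singleton vec.subspace_0)
qed

lemma card_independent_pairs:
  fixes E :: "('a::{field,finite}^'n) set"
  assumes "vec.subspace E"
  shows "card (SIGMA x:E - {0}. E - vec.span {x})
    = (CARD('a) ^ vec.dim E - 1) * (CARD('a) ^ vec.dim E - CARD('a))"
proof -
  have "card (E - vec.span {x}) = CARD('a) ^ vec.dim E - CARD('a)" if "x \<in> E - {0}" for x
  proof -
    have "vec.span {x} \<subseteq> E" using that assms by (simp add: vec.span_minimal)
    moreover have "card (vec.span {x}) = CARD('a)"
      using that card_subspace[of "vec.span {x}"] dim_span_singleton[of x] by simp
    ultimately show ?thesis using card_subspace[OF assms] by (simp add: card_Diff_subset)
  qed
  moreover have "card (E - {0}) = CARD('a) ^ vec.dim E - 1"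
    using assms by (simp add: card_subspace card_Diff_singleton vec.subspace_0)
  ultimately show ?thesis by simp
qed

text \<open>Ordered independent pairs in \<open>E\<close> are sorted by the line they span;
  \<open>card_independent_pairs\<close> counts them both in \<open>E\<close> and in each
  line.\<close>

lemma card_lines:
  fixes E :: "('a::{field,finite}^'n) set"
  assumes "vec.subspace E"
  defines "q \<equiv> CARD('a)"
  shows "card {W \<in> subspaces_of E. vec.dim W = 2} * ((q ^ 2 - 1) * (q ^ 2 - q))
     = (q ^ vec.dim E - 1) * (q ^ vec.dim E - q)"
proof -
  let ?L = "{W \<in> subspaces_of E. vec.dim W = 2}"
  let ?P = "\<lambda>W. SIGMA x:W - {0}. W - vec.span {x :: 'a^'n}"
  have span: "vec.span {x, y} = W" if "(x, y) \<in> ?P W" "W \<in> ?L" for x y W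
    using that span_eq_subspace[of "{x, y}" W] by (simp add: dim_span_pair subspaces_of_def)
  have "?P E = (\<Union>W\<in>?L. ?P W)"
  proof (intro set_eqI iffI)
    fix z assume "z \<in> ?P E"
    then obtain x y where xy: "z = (x, y)" "x \<in> E" "x \<noteq> 0" "y \<in> E" "y \<notin> vec.span {x}" by blast
    then have "vec.span {x, y} \<in> ?L" "z \<in> ?P (vec.span {x, y})"
      using span_pair_in[of x E y] assms dim_span_pair[of x y] by (auto intro: vec.span_base)
    then show "z \<in> (\<Union>W\<in>?L. ?P W)" by blast
  qed (auto simp: subspaces_of_def)
  moreover have "card (\<Union>W\<in>?L. ?P W) = (\<Sum>W\<in>?L. card (?P W))"
  proof (rule card_UN_disjoint; (intro ballI impI)?)
    fix W W' assume "W \<in> ?L" "W' \<in> ?L" "W \<noteq> W'"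
    then show "?P W \<inter> ?P W' = {}" using span by (metis (no_types, lifting) disjoint_iff surj_pair)
  qed simp_all
  moreover have "card (?P W) = (q ^ 2 - 1) * (q ^ 2 - q)" if "W \<in> ?L" for W
    using that card_independent_pairs[of W] by (simp add: subspaces_of_def q_def)
  ultimately show ?thesis
    using card_independent_pairs[OF assms(1)] by (simp add: q_def)
qed

subsection \<open>Rank functions\<close>

context
  fixes E :: "('a::{field,finite}^'n) set" and \<rho> :: "('a^'n) set \<Rightarrow> nat"
  assumes M: "q_matroid E \<rho>"
begin

lemma rk_ground: "vec.subspace E"
  using M unfolding q_matroid_def subspace_sum_def by blast

lemma rk_extensional: "\<rho> \<in> extensional (subspaces_of E)"
  using M unfolding q_matroid_def subspace_sum_def by blast

lemma rk_le_dim: "V \<in> subspaces_of E \<Longrightarrow> \<rho> V \<le> vec.dim V"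
  using M unfolding q_matroid_def subspace_sum_def by blast

lemma rk_mono: "V \<in> subspaces_of E \<Longrightarrow> W \<in> subspaces_of E \<Longrightarrow> V \<subseteq> W \<Longrightarrow> \<rho> V \<le> \<rho> W"
  using M unfolding q_matroid_def subspace_sum_def by blast

lemma rk_submodular:
  "V \<in> subspaces_of E \<Longrightarrow> W \<in> subspaces_of E \<Longrightarrow> \<rho> (V \<oplus> W) + \<rho> (V \<inter> W) \<le> \<rho> V + \<rho> W"
  using M unfolding q_matroid_def subspace_sum_def by blast

lemma rk_sum_le:
  "V \<in> subspaces_of E \<Longrightarrow> W \<in> subspaces_of E \<Longrightarrow> \<rho> (V \<oplus> W) \<le> \<rho> V + \<rho> W"
  using rk_submodular[of V W] by simp

lemma rk_zero: "\<rho> {0} = 0"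
  using rk_le_dim[OF subspaces_of_zero[OF rk_ground]] dim_zero by simp

text \<open>The closure of \<open>J\<close>. The intersection of two superspaces of rank
  \<open>\<rho> J\<close> contains \<open>J\<close>, so submodularity keeps the rank of their sum at
  \<open>\<rho> J\<close>; a maximal such superspace absorbs all others.\<close>

lemma closure_exists:
  assumes J: "J \<in> subspaces_of E"
  obtains V where "V \<in> subspaces_of E" "J \<subseteq> V" "\<rho> V = \<rho> J"
    "\<And>W. W \<in> subspaces_of E \<Longrightarrow> J \<subseteq> W \<Longrightarrow> \<rho> W = \<rho> J \<Longrightarrow> W \<subseteq> V"
proof -
  let ?S = "{V \<in> subspaces_of E. J \<subseteq> V \<and> \<rho> V = \<rho> J}"
  obtain V where V: "V \<in> ?S" and max: "\<And>U. U \<in> ?S \<Longrightarrow> V \<subseteq> U \<Longrightarrow> V = U"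
    using finite_has_maximal2[of ?S J] J by auto
  have "W \<subseteq> V" if W: "W \<in> subspaces_of E" "J \<subseteq> W" "\<rho> W = \<rho> J" for W
  proof -
    have mem: "V \<in> subspaces_of E" "V \<oplus> W \<in> subspaces_of E" "V \<inter> W \<in> subspaces_of E"
      using V W subspaces_of_sum[OF rk_ground] subspaces_of_Int by auto
    have sub: "V \<subseteq> V \<oplus> W" "W \<subseteq> V \<oplus> W"
      using sum_upper1[of W V] sum_upper2[of V W] V W by (simp_all add: subspaces_of_def)
    have "\<rho> J \<le> \<rho> (V \<inter> W)" using rk_mono[OF J mem(3)] V W by auto
    then have "\<rho> (V \<oplus> W) \<le> \<rho> J" using rk_submodular[OF mem(1) W(1)] V W by simp
    moreover have "\<rho> V \<le> \<rho> (V \<oplus> W)" using rk_mono[OF mem(1,2) sub(1)] .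
    ultimately have "V \<oplus> W \<in> ?S" using V mem sub by auto
    then show ?thesis using max sub by blast
  qed
  then show ?thesis using that V by blast
qed

text \<open>Splitting \<open>J\<close> as \<open>C \<oplus> I\<close> gives \<open>vec.dim J \<le>
  \<rho> C + \<rho> I \<le> vec.dim C + vec.dim I\<close>, whose outer terms agree.\<close>

lemma independent_subspace:
  assumes I: "I \<in> subspaces_of E" and J: "J \<in> subspaces_of E" "\<rho> J = vec.dim J" and "I \<subseteq> J"
  shows "\<rho> I = vec.dim I"
proof -
  obtain C where C: "C \<in> subspaces_of J" "C \<oplus> I = J" "vec.dim J = vec.dim C + vec.dim I"
    using complement_exists[of I J] assms subspaces_ofD by metis
  have CE: "C \<in> subspaces_of E" using C(1) J(1) by (auto simp: subspaces_of_def)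
  have "vec.dim J \<le> \<rho> C + \<rho> I" using rk_sum_le[OF CE I] C J by simp
  then show ?thesis using rk_le_dim[OF CE] rk_le_dim[OF I] C by simp
qed

text \<open>Let \<open>J\<close> be maximal independent between \<open>I\<close> and
  \<open>W\<close>. Adding a vector of \<open>W\<close> outside \<open>J\<close> gives a dependent
  space and hence no more rank, so the vector lies in the closure \<open>V\<close> of
  \<open>J\<close>. Thus \<open>W \<subseteq> V\<close>.\<close>

lemma independent_extend:
  assumes I: "I \<in> subspaces_of E" "\<rho> I = vec.dim I" and W: "W \<in> subspaces_of E" "I \<subseteq> W"
  obtains J where "J \<in> subspaces_of E" "I \<subseteq> J" "J \<subseteq> W" "\<rho> J = vec.dim J" "\<rho> J = \<rho> W"
proof -
  let ?S = "{J \<in> subspaces_of E. I \<subseteq> J \<and> J \<subseteq> W \<and> \<rho> J = vec.dim J}"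
  obtain J where J: "J \<in> ?S" and max: "\<And>U. U \<in> ?S \<Longrightarrow> J \<subseteq> U \<Longrightarrow> J = U"
    using finite_has_maximal2[of ?S I] assms by auto
  obtain V where V: "V \<in> subspaces_of E" "J \<subseteq> V" "\<rho> V = \<rho> J"
    "\<And>W. W \<in> subspaces_of E \<Longrightarrow> J \<subseteq> W \<Longrightarrow> \<rho> W = \<rho> J \<Longrightarrow> W \<subseteq> V"
    using closure_exists[of J] J by blast
  have sJ: "vec.subspace J" "J \<in> subspaces_of E" using J by (auto simp: subspaces_of_def)
  have "W \<subseteq> V"
  proof
    fix x assume x: "x \<in> W"
    show "x \<in> V"
    proof (cases "x \<in> J")
      case False
      let ?K = "J \<oplus> vec.span {x}"
      have "x \<in> E" using x W by (auto simp: subspaces_of_def)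
      then have xE: "vec.span {x} \<in> subspaces_of E" using span_singleton_in rk_ground by blast
      have K: "?K \<in> subspaces_of E" using subspaces_of_sum[OF rk_ground sJ(2) xE] .
      have sub: "J \<subseteq> ?K" "vec.span {x} \<subseteq> ?K"
        using sum_upper1[of "vec.span {x}" J] sum_upper2[of J] sJ by simp_all
      have xK: "x \<in> ?K" using sub(2) vec.span_base by blast
      have "?K \<subseteq> W"
        using sum_least[of W J "vec.span {x}"] W x J vec.span_minimal[of "{x}" W] by (simp add: subspaces_of_def)
      moreover have "?K \<noteq> J" using xK False by blast
      ultimately have "\<rho> ?K \<noteq> vec.dim ?K" using max[of ?K] J K sub by blast
      then have 1: "\<rho> ?K < vec.dim ?K" using rk_le_dim[OF K] by simp
      have "x \<noteq> 0" using False sJ vec.subspace_0 by blast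
      then have "vec.dim ?K \<le> vec.dim J + 1"
        using dim_sum_Int[OF sJ(1) vec.subspace_span, of "{x}"] dim_span_singleton[of x] by simp
      then have "\<rho> ?K \<le> \<rho> J" using 1 J by simp
      then have "\<rho> ?K = \<rho> J" using rk_mono[OF sJ(2) K sub(1)] by simp
      then have "?K \<subseteq> V" using V(4)[OF K sub(1)] by blast
      then show ?thesis using xK by blast
    qed (use V in blast)
  qed
  then have "\<rho> J = \<rho> W" using rk_mono[OF W(1) V(1)] rk_mono[OF sJ(2) W(1)] V J by simp
  then show ?thesis using that J by blast
qed

text \<open>The usual contraction, with \<open>W \<oplus> T\<close> standing for the preimage of a
  subspace of the quotient. This map respects sums; for intersections only \<open>(V \<inter> W)
  \<oplus> T \<subseteq> (V \<oplus> T) \<inter> (W \<oplus> T)\<close> is used, which is the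
  direction submodularity asks for.\<close>

lemma contraction:
  assumes T: "T \<in> subspaces_of E" and C: "C \<in> subspaces_of E"
  shows "q_matroid C (restrict (\<lambda>W. \<rho> (W \<oplus> T) - \<rho> T) (subspaces_of C))"
proof -
  have CE: "V \<in> subspaces_of E" if "V \<in> subspaces_of C" for V
    using that C by (auto simp: subspaces_of_def)
  have sum: "V \<oplus> T \<in> subspaces_of E" if "V \<in> subspaces_of C" for V
    using subspaces_of_sum[OF rk_ground CE[OF that] T] .
  \<comment> \<open>Ensures that the natural subtraction of \<open>\<rho> T\<close> never
    truncates.\<close>
  have T_le: "\<rho> T \<le> \<rho> (V \<oplus> T)" if "V \<in> subspaces_of C" for V
    using rk_mono[OF T sum[OF that] sum_upper2] that by (simp add: subspaces_of_def)
  have sC: "vec.subspace C" using C by (simp add: subspaces_of_def)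
  have sT: "vec.subspace T" using T by (simp add: subspaces_of_def)
  show ?thesis
    unfolding q_matroid_def subspace_sum_def[symmetric]
  proof (intro conjI ballI impI)
    fix V assume V: "V \<in> subspaces_of C"
    show "restrict (\<lambda>W. \<rho> (W \<oplus> T) - \<rho> T) (subspaces_of C) V \<le> vec.dim V"
      using V rk_sum_le[OF CE[OF V] T] rk_le_dim[OF CE[OF V]] by simp
    fix W assume W: "W \<in> subspaces_of C"
    { assume "V \<subseteq> W"
      then have "V \<oplus> T \<subseteq> W \<oplus> T" by (intro subspace_sum_mono subset_refl)
      then have "\<rho> (V \<oplus> T) \<le> \<rho> (W \<oplus> T)" using rk_mono[OF sum[OF V] sum[OF W]] by blast
      then show "restrict (\<lambda>W. \<rho> (W \<oplus> T) - \<rho> T) (subspaces_of C) V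
        \<le> restrict (\<lambda>W. \<rho> (W \<oplus> T) - \<rho> T) (subspaces_of C) W"
        using V W by simp }
    have VW: "V \<inter> W \<in> subspaces_of C" "V \<oplus> W \<in> subspaces_of C"
      using V W subspaces_of_Int subspaces_of_sum[OF sC] by blast+
    have eq: "(V \<oplus> T) \<oplus> (W \<oplus> T) = (V \<oplus> W) \<oplus> T"
    proof
      have m: "vec.subspace ((V \<oplus> W) \<oplus> T)"
        using sum[OF VW(2)] by (rule subspaces_ofD)
      show "(V \<oplus> T) \<oplus> (W \<oplus> T) \<subseteq> (V \<oplus> W) \<oplus> T"
        using m V W
        by (intro sum_least subspace_sum_mono subset_refl sum_upper1 sum_upper2) (simp_all add: subspaces_of_def)
      show "(V \<oplus> W) \<oplus> T \<subseteq> (V \<oplus> T) \<oplus> (W \<oplus> T)"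
      proof (rule sum_least)
        show "vec.subspace ((V \<oplus> T) \<oplus> (W \<oplus> T))"
          using subspace_sum subspaces_ofD[OF sum[OF V]] subspaces_ofD[OF sum[OF W]] by blast
        show "V \<oplus> W \<subseteq> (V \<oplus> T) \<oplus> (W \<oplus> T)"
          by (intro subspace_sum_mono sum_upper1 sT)
        show "T \<subseteq> (V \<oplus> T) \<oplus> (W \<oplus> T)"
          using sum_upper2[of V T] sum_upper1[of "W \<oplus> T" "V \<oplus> T"]
            subspaces_ofD[OF sum[OF W]] subspaces_ofD[OF V] by blast
      qed
    qed
    have "\<rho> ((V \<inter> W) \<oplus> T) \<le> \<rho> ((V \<oplus> T) \<inter> (W \<oplus> T))"
      by (rule rk_mono[OF sum[OF VW(1)] subspaces_of_Int[OF sum[OF V] sum[OF W]]]) (auto simp: subspace_sum_def)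
    then have "\<rho> ((V \<oplus> W) \<oplus> T) + \<rho> ((V \<inter> W) \<oplus> T) \<le> \<rho> (V \<oplus> T) + \<rho> (W \<oplus> T)"
      using rk_submodular[OF sum[OF V] sum[OF W]] unfolding eq by linarith
    then show "restrict (\<lambda>W. \<rho> (W \<oplus> T) - \<rho> T) (subspaces_of C) (V \<oplus> W)
        + restrict (\<lambda>W. \<rho> (W \<oplus> T) - \<rho> T) (subspaces_of C) (V \<inter> W)
      \<le> restrict (\<lambda>W. \<rho> (W \<oplus> T) - \<rho> T) (subspaces_of C) V
        + restrict (\<lambda>W. \<rho> (W \<oplus> T) - \<rho> T) (subspaces_of C) W"
      using V W VW T_le[OF V] T_le[OF W] T_le[OF VW(1)] T_le[OF VW(2)] by simp
  qed (use sC in simp_all)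
qed

end

section \<open>Bases determine the rank function\<close>

text \<open>A \<open>\<rho>\<close>-independent \<open>I \<subseteq> V\<close> of rank
  \<open>\<rho> V\<close> extends to a basis \<open>B\<close> for \<open>\<rho>\<close>. As
  \<open>B\<close> is independent for \<open>\<sigma>\<close> too, so is \<open>I\<close>, whence
  \<open>\<sigma> V \<ge> vec.dim I = \<rho> V\<close>.\<close>

lemma rk_le_of_bases:
  assumes M1: "q_matroid E \<rho>" and M2: "q_matroid E \<sigma>"
    and bases: "\<And>B. B \<in> subspaces_of E \<Longrightarrow> vec.dim B = \<rho> E \<Longrightarrow> \<rho> B = \<rho> E \<Longrightarrow> \<sigma> B = \<rho> E"
    and V: "V \<in> subspaces_of E"
  shows "\<rho> V \<le> \<sigma> V"
proof -
  have E: "vec.subspace E" "E \<in> subspaces_of E"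
    using rk_ground[OF M1] by (simp_all add: subspaces_of_self)
  obtain I where I: "I \<in> subspaces_of E" "I \<subseteq> V" "\<rho> I = vec.dim I" "\<rho> I = \<rho> V"
    using independent_extend[OF M1 subspaces_of_zero[OF E(1)] _ V] rk_zero[OF M1]
      vec.subspace_0[OF subspaces_ofD(1)[OF V]] dim_zero by auto
  obtain B where B: "B \<in> subspaces_of E" "I \<subseteq> B" "\<rho> B = vec.dim B" "\<rho> B = \<rho> E"
    using independent_extend[OF M1 I(1) I(3) E(2)] subspaces_ofD[OF I(1)] by metis
  then have "\<sigma> B = vec.dim B" using bases by simp
  then have "\<sigma> I = vec.dim I" using independent_subspace[OF M2 I(1) B(1)] B by simp
  then show ?thesis using rk_mono[OF M2 I(1) V I(2)] I by simp
qed

lemma basis_exists: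
  assumes M: "q_matroid E \<rho>"
  obtains B where "B \<in> subspaces_of E" "vec.dim B = \<rho> E" "\<rho> B = \<rho> E"
proof -
  have E: "vec.subspace E" "\<rho> {0} = vec.dim {0}"
    using rk_ground[OF M] rk_zero[OF M] dim_zero by simp_all
  then have "{0} \<subseteq> E" using vec.subspace_0 by blast
  with that show ?thesis
    by (metis independent_extend[OF M subspaces_of_zero[OF E(1)] E(2) subspaces_of_self[OF E(1)]])
qed

lemma q_matroid_eqI:
  assumes M: "q_matroid E \<rho>" "q_matroid E \<sigma>" and "\<And>V. V \<in> subspaces_of E \<Longrightarrow> \<rho> V = \<sigma> V"
  shows "\<rho> = \<sigma>"
  using extensionalityI[OF rk_extensional[OF M(1)] rk_extensional[OF M(2)]] assms(3) by blast

text \<open>Extensional rank functions lie in a finite product of ranges. The counts rely on this,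
  since \<open>card\<close> of an infinite set is zero.\<close>

lemma finite_q_matroids: "finite {\<rho>. q_matroid (E :: ('a::{field,finite}^'n) set) \<rho> \<and> P \<rho>}"
proof (rule finite_subset)
  show "{\<rho>. q_matroid E \<rho> \<and> P \<rho>} \<subseteq> (\<Pi>\<^sub>E V\<in>subspaces_of E. {..vec.dim V})"
    by (auto simp: PiE_def Pi_iff intro: rk_extensional dest: rk_le_dim)
qed (simp add: finite_PiE)

subsection \<open>Shearer's inequality\<close>

text \<open>A form of Hoelder's inequality: geometric means are superadditive. It is what the
  inductive step of Shearer's inequality needs, with \<open>a\<close> and \<open>b\<close> the sizes
  of the two halves of the family.\<close>

lemma add_le_prod_add_of_power_le:
  fixes a b P :: real and x y :: "'i \<Rightarrow> real"
  assumes J: "finite J" "J \<noteq> {}"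
    and nn: "a \<ge> 0" "b \<ge> 0" "P \<ge> 0" "\<And>i. i \<in> J \<Longrightarrow> x i \<ge> 0" "\<And>i. i \<in> J \<Longrightarrow> y i \<ge> 0"
    and a: "a ^ card J \<le> P * (\<Prod>i\<in>J. x i)" and b: "b ^ card J \<le> P * (\<Prod>i\<in>J. y i)"
  shows "(a + b) ^ card J \<le> P * (\<Prod>i\<in>J. x i + y i)"
proof (cases "\<exists>i\<in>J. x i + y i = 0")
  \<comment> \<open>A vanishing \<open>x i + y i\<close> cannot be a denominator below, but it
    forces \<open>a = b = 0\<close>.\<close>
  case True
  then obtain i where i: "i \<in> J" "x i = 0" "y i = 0"
    using nn by (meson add_nonneg_eq_0_iff)
  then have "(\<Prod>i\<in>J. x i) = 0" "(\<Prod>i\<in>J. y i) = 0" using J by (auto intro!: prod_zero)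
  then have "a ^ card J \<le> 0" "b ^ card J \<le> 0" using a b by simp_all
  moreover have "card J > 0" using J by (simp add: card_gt_0_iff)
  ultimately have "a = 0" "b = 0" using nn by (meson not_less order_le_less zero_less_power)+
  then show ?thesis using J nn by (auto intro!: mult_nonneg_nonneg prod_nonneg simp: power_0_left)
next
  case False
  define k where "k = card J"
  have k: "k > 0" using J by (simp add: k_def card_gt_0_iff)
  define S where "S = P * (\<Prod>i\<in>J. x i + y i)"
  have pos: "x i + y i > 0" if "i \<in> J" for i
    using False nn(4,5)[OF that] that by (metis add_nonneg_nonneg order_le_less)
  have S: "S \<ge> 0" unfolding S_def by (intro mult_nonneg_nonneg prod_nonneg ballI nn less_imp_le[OF pos])
  \<comment> \<open>Used for \<open>z = x\<close> and for \<open>z = y\<close>: the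
    arithmetic-geometric mean inequality for the ratios \<open>z i / (x i + y i)\<close>.\<close>
  have root_le: "c \<le> root k S * (\<Sum>i\<in>J. z i / (x i + y i)) / k"
    if c: "c \<ge> 0" "c ^ k \<le> P * (\<Prod>i\<in>J. z i)" and z: "\<And>i. i \<in> J \<Longrightarrow> z i \<ge> 0" for c and z :: "'i \<Rightarrow> real"
  proof -
    let ?u = "\<lambda>i. z i / (x i + y i)"
    have u: "?u i \<ge> 0" if "i \<in> J" for i using z[OF that] pos[OF that] by simp
    have "(\<Prod>i\<in>J. z i) = (\<Prod>i\<in>J. x i + y i) * (\<Prod>i\<in>J. ?u i)"
      unfolding prod.distrib[symmetric] using pos by (intro prod.cong) (auto simp: less_imp_neq[symmetric])
    then have "c ^ k \<le> S * (\<Prod>i\<in>J. ?u i)" using c by (simp add: S_def mult.assoc)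
    then have "c \<le> root k (S * (\<Prod>i\<in>J. ?u i))"
      using c k by (metis real_root_le_iff real_root_power_cancel)
    also have "\<dots> = root k S * (\<Prod>i\<in>J. ?u i) powr (1 / k)"
    proof (cases "(\<Prod>i\<in>J. ?u i) = 0")
      case False
      then have "(\<Prod>i\<in>J. ?u i) > 0" using prod_nonneg[of J ?u] u by simp
      then show ?thesis using k by (simp only: real_root_mult root_powr_inverse)
    qed simp
    also have "\<dots> \<le> root k S * (\<Sum>i\<in>J. ?u i / k)"
      using arith_geom_mean[OF J, of ?u] u S k by (intro mult_left_mono) (auto simp: k_def)
    also have "\<dots> = root k S * (\<Sum>i\<in>J. ?u i) / k"
      by (simp only: sum_divide_distrib[symmetric] times_divide_eq_right)
    finally show ?thesis .
  qed
  \<comment> \<open>At each index the two ratios add up to one, and so do the two averages.\<close>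
  have "(\<Sum>i\<in>J. x i / (x i + y i)) + (\<Sum>i\<in>J. y i / (x i + y i)) = (\<Sum>i\<in>J. 1)"
    unfolding sum.distrib[symmetric] add_divide_distrib[symmetric] using pos
    by (intro sum.cong) (auto simp: less_imp_neq[symmetric])
  then have one: "((\<Sum>i\<in>J. x i / (x i + y i)) + (\<Sum>i\<in>J. y i / (x i + y i))) / k = 1"
    using k by (simp add: k_def)
  have "a + b \<le> root k S * (((\<Sum>i\<in>J. x i / (x i + y i)) + (\<Sum>i\<in>J. y i / (x i + y i))) / k)"
    using root_le[of a x] root_le[of b y] nn a b by (simp add: k_def field_simps add_divide_distrib)
  then have "a + b \<le> root k S" unfolding one by simp
  then have "(a + b) ^ k \<le> root k S ^ k" using nn by (intro power_mono) simp_all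
  then show ?thesis using k S by (simp add: S_def k_def)
qed

text \<open>Induction on the ground set: \<open>F\<close> is split by membership of the new element
  \<open>s\<close>. For the \<open>k\<close> sets \<open>A i\<close> containing \<open>s\<close>,
  the traces of the two halves are separated by \<open>s\<close>, so their numbers add up; Hoelder's
  inequality combines the two induction hypotheses.\<close>

lemma Shearer_card:
  fixes F :: "'s set set"
  assumes "finite S" "finite I" "k > 0" "F \<subseteq> Pow S"
    and "\<And>s. s \<in> S \<Longrightarrow> card {i \<in> I. s \<in> A i} = k"
  shows "card F ^ k \<le> (\<Prod>i\<in>I. card ((\<lambda>X. X \<inter> A i) ` F))"
  using assms(1,4,5)
proof (induction S arbitrary: F rule: finite_induct)
  case empty
  show ?case
  proof (cases "F = {}")
    case False
    then have "F = {{}}" using empty.prems(1) by auto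
    then show ?thesis by simp
  qed (use \<open>k > 0\<close> in \<open>simp add: power_0_left\<close>)
next
  case (insert s S)
  have finF: "finite F" using insert by (meson finite.insertI finite_Pow_iff finite_subset)
  define F0 where "F0 = {X \<in> F. s \<notin> X}"
  define F1 where "F1 = (\<lambda>X. X - {s}) ` {X \<in> F. s \<in> X}"
  have fin: "finite F0" "finite F1" using finF by (simp_all add: F0_def F1_def)
  let ?tr = "\<lambda>F i. (\<lambda>X. X \<inter> A i) ` F"
  have inj: "inj_on (\<lambda>X. X - {s}) {X \<in> F. s \<in> X}" by (auto simp: inj_on_def)
  have "F = F0 \<union> {X \<in> F. s \<in> X}" "F0 \<inter> {X \<in> F. s \<in> X} = {}" by (auto simp: F0_def)
  then have "card F = card F0 + card {X \<in> F. s \<in> X}" using finF by (metis card_Un_disjoint finite_Un)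
  then have cF: "card F = card F0 + card F1" using card_image[OF inj] by (simp add: F1_def)
  have sub: "F0 \<subseteq> Pow S" "F1 \<subseteq> Pow S" using insert.prems by (auto simp: F0_def F1_def)
  have IH: "card F0 ^ k \<le> (\<Prod>i\<in>I. card (?tr F0 i))" "card F1 ^ k \<le> (\<Prod>i\<in>I. card (?tr F1 i))"
    using insert.IH[OF sub(1)] insert.IH[OF sub(2)] insert.prems(2) by simp_all
  define J where "J = {i \<in> I. s \<in> A i}"
  have J: "finite J" "card J = k" "J \<subseteq> I" using insert.prems(2)[of s] assms(2) by (simp_all add: J_def)
  have Jne: "J \<noteq> {}" using J \<open>k > 0\<close> by auto
  have trJ: "card (?tr F0 i) + card (?tr F1 i) = card (?tr F i)" if i: "i \<in> J" for i
  proof -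
    have si: "s \<in> A i" using i by (simp add: J_def)
    have "?tr F i = ?tr F0 i \<union> insert s ` ?tr F1 i"
    proof (intro set_eqI iffI)
      fix Z assume "Z \<in> ?tr F i"
      then obtain X where X: "X \<in> F" "Z = X \<inter> A i" by blast
      show "Z \<in> ?tr F0 i \<union> insert s ` ?tr F1 i"
      proof (cases "s \<in> X")
        case True
        then have "Z = insert s ((X - {s}) \<inter> A i)" "X - {s} \<in> F1" using X si by (auto simp: F1_def)
        then show ?thesis by blast
      qed (use X in \<open>auto simp: F0_def\<close>)
    next
      fix Z assume "Z \<in> ?tr F0 i \<union> insert s ` ?tr F1 i"
      then show "Z \<in> ?tr F i"
      proof
        assume "Z \<in> insert s ` ?tr F1 i"
        then obtain X where "X \<in> F" "s \<in> X" "Z = insert s ((X - {s}) \<inter> A i)" by (auto simp: F1_def)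
        then have "X \<in> F" "Z = X \<inter> A i" using si by auto
        then show ?thesis by blast
      qed (auto simp: F0_def)
    qed
    moreover have "?tr F0 i \<inter> insert s ` ?tr F1 i = {}" by (auto simp: F0_def)
    moreover have "card (insert s ` ?tr F1 i) = card (?tr F1 i)"
      by (rule card_image) (auto simp: inj_on_def F1_def)
    ultimately show ?thesis using fin by (simp add: card_Un_disjoint)
  qed
  \<comment> \<open>When \<open>s\<close> is not in \<open>A i\<close>, deleting \<open>s\<close>
    leaves the trace unchanged, so both halves are merely bounded by the trace of \<open>F\<close>.
    These factors are common to both estimates and form \<open>P\<close>.\<close>
  have trI: "card (?tr F0 i) \<le> card (?tr F i)" "card (?tr F1 i) \<le> card (?tr F i)" if i: "i \<in> I - J" for i
  proof -
    have "s \<notin> A i" using i by (simp add: J_def)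
    then have "(X - {s}) \<inter> A i = X \<inter> A i" for X by blast
    then have "?tr F1 i \<subseteq> ?tr F i" by (auto simp: F1_def)
    moreover have "?tr F0 i \<subseteq> ?tr F i" by (auto simp: F0_def)
    ultimately show "card (?tr F0 i) \<le> card (?tr F i)" "card (?tr F1 i) \<le> card (?tr F i)"
      using finF by (simp_all add: card_mono)
  qed
  define P where "P = (\<Prod>i\<in>I - J. card (?tr F i))"
  have split: "(\<Prod>i\<in>I. g i) = (\<Prod>i\<in>I - J. g i) * (\<Prod>i\<in>J. g i)" for g :: "_ \<Rightarrow> nat"
    using prod.subset_diff[OF J(3) assms(2)] .
  have le: "card G ^ k \<le> P * (\<Prod>i\<in>J. card (?tr G i))"
    if "card G ^ k \<le> (\<Prod>i\<in>I. card (?tr G i))" "\<And>i. i \<in> I - J \<Longrightarrow> card (?tr G i) \<le> card (?tr F i)" for G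
    using that(1) unfolding split P_def
    by (rule order_trans) (intro mult_right_mono prod_mono conjI that(2); simp)
  have "(real (card F0) + real (card F1)) ^ card J
      \<le> real P * (\<Prod>i\<in>J. real (card (?tr F0 i)) + real (card (?tr F1 i)))"
  proof (rule add_le_prod_add_of_power_le[OF J(1) Jne])
    have "real (card F0 ^ k) \<le> real (P * (\<Prod>i\<in>J. card (?tr F0 i)))" using le[OF IH(1) trI(1)] by (rule of_nat_mono)
    then show "real (card F0) ^ card J \<le> real P * (\<Prod>i\<in>J. real (card (?tr F0 i)))" by (simp add: J(2))
    have "real (card F1 ^ k) \<le> real (P * (\<Prod>i\<in>J. card (?tr F1 i)))" using le[OF IH(2) trI(2)] by (rule of_nat_mono)
    then show "real (card F1) ^ card J \<le> real P * (\<Prod>i\<in>J. real (card (?tr F1 i)))" by (simp add: J(2))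
  qed simp_all
  then have "real (card F ^ k) \<le> real (P * (\<Prod>i\<in>J. card (?tr F0 i) + card (?tr F1 i)))"
    unfolding cF by (simp add: J(2))
  then have "card F ^ k \<le> P * (\<Prod>i\<in>J. card (?tr F0 i) + card (?tr F1 i))"
    by (simp only: of_nat_le_iff)
  also have "\<dots> = (\<Prod>i\<in>I. card (?tr F i))"
    unfolding split P_def using trJ by simp
  finally show ?case .
qed

subsection \<open>Numerical estimates\<close>

text \<open>The optimal choice \<open>t = \<kappa> / card A\<close> gives the bound \<open>(e card A / \<kappa>) powr \<kappa>\<close>.\<close>

lemma card_small_subsets_le:
  fixes \<kappa> t :: real
  assumes "finite A" "0 < t" "t \<le> 1"
  shows "real (card {X \<in> Pow A. real (card X) \<le> \<kappa>}) \<le> exp (t * card A) * t powr (- \<kappa>)"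
proof -
  \<comment> \<open>Weighting each subset by \<open>t ^ card X\<close> turns the count into a
    generating function, summed by the binomial theorem.\<close>
  have "(\<Sum>X\<in>Pow A. t ^ card X) = (1 + t) ^ card A"
    using \<open>finite A\<close>
  proof (induction A rule: finite_induct)
    case (insert x A)
    have "(\<Sum>X\<in>insert x ` Pow A. t ^ card X) = (\<Sum>X\<in>Pow A. t ^ card (insert x X))"
      by (rule sum.reindex_cong[where l = "insert x"]) (use insert.hyps in \<open>auto simp: inj_on_def\<close>)
    also have "\<dots> = (\<Sum>X\<in>Pow A. t * t ^ card X)"
      using insert.hyps by (intro sum.cong) (auto simp: card_insert_if finite_subset)
    finally have 1: "(\<Sum>X\<in>insert x ` Pow A. t ^ card X) = t * (1 + t) ^ card A"
      using insert.IH by (simp add: sum_distrib_left[symmetric])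
    have "(\<Sum>X\<in>Pow (insert x A). t ^ card X) = (\<Sum>X\<in>Pow A. t ^ card X) + (\<Sum>X\<in>insert x ` Pow A. t ^ card X)"
      unfolding Pow_insert using insert.hyps by (intro sum.union_disjoint) auto
    then show ?case using 1 insert by (simp add: algebra_simps)
  qed simp
  also have "\<dots> \<le> exp t ^ card A" using assms by (intro power_mono) auto
  also have "\<dots> = exp (t * card A)" by (simp add: exp_of_nat2_mult)
  finally have sum_le: "(\<Sum>X\<in>Pow A. t ^ card X) \<le> exp (t * card A)" .
  \<comment> \<open>Since \<open>t \<le> 1\<close>, every small set has weight at least
    \<open>t powr \<kappa>\<close>.\<close>
  have "t powr \<kappa> * card {X \<in> Pow A. real (card X) \<le> \<kappa>} = (\<Sum>X\<in>{X \<in> Pow A. real (card X) \<le> \<kappa>}. t powr \<kappa>)"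
    by simp
  also have "\<dots> \<le> (\<Sum>X\<in>{X \<in> Pow A. real (card X) \<le> \<kappa>}. t ^ card X)"
    using assms by (intro sum_mono) (auto simp: powr_realpow[symmetric] intro!: powr_mono')
  also have "\<dots> \<le> (\<Sum>X\<in>Pow A. t ^ card X)"
    using assms by (intro sum_mono2) auto
  finally show ?thesis using sum_le assms by (simp add: powr_minus field_simps)
qed

subsection \<open>Counting q-matroids of rank two\<close>

lemma sum_Int_complement:
  assumes "vec.subspace V" "T \<subseteq> V" "C \<oplus> T = E" "V \<subseteq> E"
  shows "(V \<inter> C) \<oplus> T = V"
  using modular_law[OF assms(1,2), of C] assms by blast

text \<open>Adding a loop \<open>p\<close> to a subspace leaves its rank unchanged, so
  \<open>\<rho>\<close> is recovered from its contraction by \<open>p\<close>, which has the same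
  rank and lives on a hyperplane complementary to \<open>p\<close>.\<close>

lemma card_loop_le:
  assumes C: "vec.subspace C" and p: "p \<in> subspaces_of C" "vec.dim p = 1"
    and bound: "\<And>K. K \<in> subspaces_of C \<Longrightarrow> Suc (vec.dim K) = vec.dim C \<Longrightarrow> num_q_matroids K r \<le> N"
  shows "card {\<rho>. q_matroid C \<rho> \<and> \<rho> C = r \<and> \<rho> p = 0} \<le> N"
proof -
  obtain K where K: "K \<in> subspaces_of C" "K \<oplus> p = C" "vec.dim C = vec.dim K + vec.dim p"
    using complement_exists[of p C] C subspaces_ofD[OF p(1)] by metis
  let ?R = "{\<rho>. q_matroid C \<rho> \<and> \<rho> C = r \<and> \<rho> p = 0}"
  let ?\<phi> = "\<lambda>\<rho>. restrict (\<lambda>W. \<rho> (W \<oplus> p) - \<rho> p) (subspaces_of K)"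
  have sK: "vec.subspace K" using K by (simp add: subspaces_of_def)
  have "card ?R \<le> card {\<rho>. q_matroid K \<rho> \<and> \<rho> K = r}"
  proof (rule card_inj_on_le)
    show "inj_on ?\<phi> ?R"
    proof (rule inj_onI)
      fix \<rho> \<sigma> assume \<rho>: "\<rho> \<in> ?R" and \<sigma>: "\<sigma> \<in> ?R" and eq: "?\<phi> \<rho> = ?\<phi> \<sigma>"
      show "\<rho> = \<sigma>"
      proof (rule q_matroid_eqI)
        fix V assume V: "V \<in> subspaces_of C"
        let ?W = "(V \<oplus> p) \<inter> K"
        have Vp: "V \<oplus> p \<in> subspaces_of C" using subspaces_of_sum[OF C V p(1)] .
        have "p \<subseteq> V \<oplus> p" using sum_upper2[of V p] V by (simp add: subspaces_of_def)
        then have W: "?W \<oplus> p = V \<oplus> p" using sum_Int_complement K(2) subspaces_ofD[OF Vp] by blast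
        have WK: "?W \<in> subspaces_of K" using Vp K by (auto simp: subspaces_of_def vec.subspace_inter)
        have *: "\<tau> V = ?\<phi> \<tau> ?W" if "\<tau> \<in> ?R" for \<tau>
        proof -
          have \<tau>: "q_matroid C \<tau>" "\<tau> p = 0" using that by auto
          have "\<tau> V \<le> \<tau> (V \<oplus> p)"
            using rk_mono[OF \<tau>(1) V Vp] sum_upper1[of p V] p by (simp add: subspaces_of_def)
          then show ?thesis using rk_sum_le[OF \<tau>(1) V p(1)] \<tau> W WK by simp
        qed
        show "\<rho> V = \<sigma> V" using *[OF \<rho>] *[OF \<sigma>] eq by simp
      qed (use \<rho> \<sigma> in auto)
    qed
    show "?\<phi> ` ?R \<subseteq> {\<rho>. q_matroid K \<rho> \<and> \<rho> K = r}"
    proof clarify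
      fix \<rho> assume "q_matroid C \<rho>" "\<rho> p = 0"
      moreover from this have "q_matroid K (?\<phi> \<rho>)" using contraction[OF _ p(1) K(1)] by blast
      ultimately show "q_matroid K (?\<phi> \<rho>) \<and> ?\<phi> \<rho> K = \<rho> C"
        using K subspaces_of_self[OF sK] by auto
    qed
  qed (rule finite_q_matroids)
  also have "\<dots> \<le> N" using bound[OF K(1)] K p by (simp add: num_q_matroids_def)
  finally show ?thesis .
qed

text \<open>Extend \<open>b\<close> to a basis of \<open>F\<close> and join \<open>b\<close> to each
  other basis vector. In dimension one this gives no line at all, hence the condition in the last
  claim.\<close>

lemma star_exists:
  assumes F: "vec.subspace F" and b: "b \<in> F" "b \<noteq> 0"
  obtains X where "X \<subseteq> {W \<in> subspaces_of F. vec.dim W = 2 \<and> b \<in> W}" "card X < vec.dim F"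
    "2 \<le> vec.dim F \<Longrightarrow> F \<subseteq> vec.span (\<Union>X)"
proof -
  obtain B where B: "{b} \<subseteq> B" "B \<subseteq> F" "vec.independent B" "F \<subseteq> vec.span B"
    using vec.maximal_independent_subset_extend[of "{b}" F] b by auto
  have dim: "vec.dim F = card B" using vec.basis_card_eq_dim[OF B(2,4,3)] by simp
  let ?X = "(\<lambda>y. vec.span {b, y}) ` (B - {b})"
  show ?thesis
  proof
    show "?X \<subseteq> {W \<in> subspaces_of F. vec.dim W = 2 \<and> b \<in> W}"
    proof clarify
      fix y assume y: "y \<in> B" "y \<noteq> b"
      then have "vec.independent {b, y}" using vec.independent_mono[OF B(3), of "{b, y}"] B(1) by simp
      then have "vec.dim (vec.span {b, y}) = 2" using vec.dim_span_eq_card_independent y by fastforce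
      then show "vec.span {b, y} \<in> subspaces_of F \<and> vec.dim (vec.span {b, y}) = 2 \<and> b \<in> vec.span {b, y}"
        using span_pair_in[of b F y] y B(2) F b vec.span_base[of b "{b, y}"] by blast
    qed
    have "card ?X \<le> card (B - {b})" by (rule card_image_le) simp
    also have "\<dots> < card B" using B(1) by (intro psubset_card_mono) auto
    finally show "card ?X < vec.dim F" using dim by simp
    assume "2 \<le> vec.dim F"
    then have "B - {b} \<noteq> {}" using dim card_mono[of "{b}" B] by (auto simp: Diff_eq_empty_iff)
    then obtain y where y: "y \<in> B - {b}" by blast
    have "B \<subseteq> \<Union>?X"
    proof
      fix z assume "z \<in> B"
      then show "z \<in> \<Union>?X"
        using y vec.span_base[of b "{b, y}"] vec.span_base[of z "{b, z}"] by (cases "z = b") auto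
    qed
    then show "F \<subseteq> vec.span (\<Union>?X)" using B(4) vec.span_mono by blast
  qed
qed

text \<open>This is d - 1 <= [d]_q / [2]_q cleared of denominators, with equality at
  \<open>d = 2\<close>. It charges each line of a star to \<open>q\<^sup>2 - 1\<close> nonzero
  vectors of the flat.\<close>

lemma pred_mult_le_power_minus_one:
  fixes q d :: nat
  assumes "q \<ge> 2" "d \<ge> 1"
  shows "(d - 1) * (q\<^sup>2 - 1) \<le> q ^ d - 1"
proof -
  have "(d - 1) * (q\<^sup>2 - 1) + 1 \<le> q ^ d" using \<open>d \<ge> 1\<close>
  proof (induction d rule: dec_induct)
    case (step d)
    show ?case
    \<comment> \<open>The doubling argument needs \<open>q\<^sup>2 \<le> q ^ d\<close>, which fails
      at \<open>d = 1\<close>.\<close>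
    proof (cases "d = 1")
      case True
      then show ?thesis using assms by (simp add: power2_eq_square Suc_le_eq)
    next
      case False
      then have "d \<ge> 2" using step by simp
      then have "q\<^sup>2 \<le> q ^ d" using assms by (intro power_increasing) auto
      moreover have "2 * q ^ d \<le> q ^ Suc d" using mult_right_mono[OF \<open>q \<ge> 2\<close>, of "q ^ d"] by simp
      moreover have "(Suc d - 1) * (q\<^sup>2 - 1) + 1 = (d - 1) * (q\<^sup>2 - 1) + 1 + (q\<^sup>2 - 1)"
        using step by (cases d) simp_all
      ultimately show ?thesis using step.IH by linarith
    qed
  qed (use assms in simp)
  then show ?thesis by simp
qed

section \<open>Codes for loopless q-matroids of rank two\<close>

definition loopless :: "('a::{field,finite}^'n) set \<Rightarrow> (('a^'n) set \<Rightarrow> nat) \<Rightarrow> bool" where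
  "loopless E \<rho> \<longleftrightarrow> (\<forall>p\<in>subspaces_of E. vec.dim p = 1 \<longrightarrow> \<rho> p \<noteq> 0)"

lemma loopless_span:
  assumes "q_matroid E \<rho>" "loopless E \<rho>" "x \<in> E" "x \<noteq> 0"
  shows "vec.span {x} \<in> subspaces_of E" "\<rho> (vec.span {x}) = 1"
proof -
  show *: "vec.span {x} \<in> subspaces_of E"
    using span_singleton_in[of x E] rk_ground[OF assms(1)] assms by blast
  show "\<rho> (vec.span {x}) = 1"
    using rk_le_dim[OF assms(1) *] dim_span_singleton[OF assms(4)] assms(2) *
    unfolding loopless_def by (metis One_nat_def le_Suc_eq le_zero_eq)
qed

lemma loopless_pos:
  assumes "q_matroid E \<rho>" "loopless E \<rho>" "W \<in> subspaces_of E" "x \<in> W" "x \<noteq> 0"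
  shows "\<rho> W \<ge> 1"
proof -
  have x: "x \<in> E" using assms by (auto simp: subspaces_of_def)
  have "vec.span {x} \<subseteq> W" using assms(3,4) by (simp add: subspaces_of_def vec.span_minimal)
  then show ?thesis
    using rk_mono[OF assms(1) loopless_span(1)[OF assms(1,2) x assms(5)] assms(3)]
      loopless_span(2)[OF assms(1,2) x assms(5)] by simp
qed

text \<open>
  Requiring the lines in \<open>S\<close> to share a vector is what makes \<open>X\<close> determine the nonbases:
  in any loopless q-matroid where all members of \<open>X\<close> have rank one, the closure of the shared
  vector contains every line in \<open>S\<close>, hence \<open>W\<close>.
\<close>

definition generates_nonbases ::
    "('a::{field,finite}^'n) set \<Rightarrow> (('a^'n) set \<Rightarrow> nat) \<Rightarrow> ('a^'n) set set \<Rightarrow> bool" where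
  "generates_nonbases E \<rho> X \<longleftrightarrow>
     X \<subseteq> {W \<in> subspaces_of E. vec.dim W = 2 \<and> \<rho> W = 1} \<and>
     (\<forall>W\<in>subspaces_of E. vec.dim W = 2 \<longrightarrow> \<rho> W = 1 \<longrightarrow>
        (\<exists>b S. b \<noteq> 0 \<and> S \<subseteq> X \<and> (\<forall>U\<in>S. b \<in> U) \<and> W \<subseteq> vec.span (\<Union>S)))"

text \<open>The code is the union of one star per rank-one flat. A rank-one line lies in the closure
  of any of its nonzero vectors and so is generated by the star of that flat.\<close>

lemma generates_nonbases_exists:
  fixes E :: "('a::{field,finite}^'n) set"
  assumes M: "q_matroid E \<rho>" and l: "loopless E \<rho>"
  defines "q \<equiv> CARD('a)"
  obtains X where "generates_nonbases E \<rho> X" "card X * (q\<^sup>2 - 1) \<le> q ^ vec.dim E - 1"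
proof -
  have q: "q \<ge> 2" unfolding q_def by (rule card_field_ge_2)
  have E: "vec.subspace E" using rk_ground[OF M] .
  have "\<forall>x\<in>E - {0}. \<exists>V. V \<in> subspaces_of E \<and> x \<in> V \<and> \<rho> V = 1 \<and>
      (\<forall>W\<in>subspaces_of E. x \<in> W \<longrightarrow> \<rho> W = 1 \<longrightarrow> W \<subseteq> V)"
  proof
    fix x assume x: "x \<in> E - {0}"
    note sp = loopless_span[OF M l, of x]
    have sub: "vec.span {x} \<subseteq> W" if "W \<in> subspaces_of E" "x \<in> W" for W
      using that by (simp add: subspaces_of_def vec.span_minimal)
    obtain V where V: "V \<in> subspaces_of E" "vec.span {x} \<subseteq> V" "\<rho> V = \<rho> (vec.span {x})"
      "\<And>W. W \<in> subspaces_of E \<Longrightarrow> vec.span {x} \<subseteq> W \<Longrightarrow> \<rho> W = \<rho> (vec.span {x}) \<Longrightarrow> W \<subseteq> V"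
      using closure_exists[OF M sp(1)] x by blast
    moreover have "x \<in> V" using V(2) vec.span_base[of x "{x}"] by blast
    ultimately show "\<exists>V. V \<in> subspaces_of E \<and> x \<in> V \<and> \<rho> V = 1 \<and>
      (\<forall>W\<in>subspaces_of E. x \<in> W \<longrightarrow> \<rho> W = 1 \<longrightarrow> W \<subseteq> V)"
      using sub sp x by (intro exI[of _ V]) auto
  qed
  then obtain cl where cl: "\<And>x. x \<in> E - {0} \<Longrightarrow> cl x \<in> subspaces_of E \<and> x \<in> cl x \<and> \<rho> (cl x) = 1"
    and cl_max: "\<And>x W. x \<in> E - {0} \<Longrightarrow> W \<in> subspaces_of E \<Longrightarrow> x \<in> W \<Longrightarrow> \<rho> W = 1 \<Longrightarrow> W \<subseteq> cl x"
    by metis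
  \<comment> \<open>Closures that share a nonzero vector coincide. This makes the flats disjoint
    away from zero, so that their charges can be added.\<close>
  have cl_eq: "cl y = cl x" if "x \<in> E - {0}" "y \<in> cl x" "y \<noteq> 0" for x y
  proof -
    have y: "y \<in> E - {0}" using that cl[of x] by (auto simp: subspaces_of_def)
    have "cl x \<subseteq> cl y" using cl_max[of y "cl x"] cl[of x] that y by blast
    moreover from this have "cl y \<subseteq> cl x" using cl_max[of x "cl y"] cl[of x] cl[of y] that y by blast
    ultimately show ?thesis by blast
  qed
  define FF where "FF = cl ` (E - {0})"
  have FF: "F \<in> subspaces_of E" "\<rho> F = 1" "\<exists>x\<in>F. x \<noteq> 0" if "F \<in> FF" for F
    using that cl by (auto simp: FF_def)
  \<comment> \<open>Center and star are put into one predicate so that both are chosen together for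
    each flat.\<close>
  define star where "star F b X \<longleftrightarrow> b \<noteq> 0 \<and> X \<subseteq> {W \<in> subspaces_of F. vec.dim W = 2 \<and> b \<in> W} \<and>
     card X < vec.dim F \<and> (2 \<le> vec.dim F \<longrightarrow> F \<subseteq> vec.span (\<Union>X))"
    for F :: "('a^'n) set" and b X
  have "\<forall>F\<in>FF. \<exists>b X. star F b X"
  proof
    fix F assume F: "F \<in> FF"
    then obtain b where b: "b \<in> F" "b \<noteq> 0" using FF(3) by blast
    have sF: "vec.subspace F" using FF(1)[OF F] by (rule subspaces_ofD)
    obtain X where "X \<subseteq> {W \<in> subspaces_of F. vec.dim W = 2 \<and> b \<in> W}" "card X < vec.dim F"
      "2 \<le> vec.dim F \<Longrightarrow> F \<subseteq> vec.span (\<Union>X)"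
      using star_exists[OF sF b] by blast
    then show "\<exists>b X. star F b X" using b unfolding star_def by blast
  qed
  then obtain b X where star: "\<And>F. F \<in> FF \<Longrightarrow> star F (b F) (X F)" by metis
  have b: "b F \<noteq> 0" and X: "X F \<subseteq> {W \<in> subspaces_of F. vec.dim W = 2 \<and> b F \<in> W}"
      "card (X F) < vec.dim F" "2 \<le> vec.dim F \<Longrightarrow> F \<subseteq> vec.span (\<Union>(X F))" if "F \<in> FF" for F
    using star[OF that] by (simp_all add: star_def)
  let ?Y = "\<Union>F\<in>FF. X F"
  have pos: "\<rho> W \<ge> 1" if W: "W \<in> subspaces_of E" "vec.dim W = 2" for W
  proof -
    have "\<not> W \<subseteq> {0}" using W(2) vec.dim_eq_0[of W] by auto
    then show ?thesis using loopless_pos[OF M l W(1)] by blast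
  qed
  have "generates_nonbases E \<rho> ?Y"
    unfolding generates_nonbases_def
  proof (intro conjI ballI impI)
    show "?Y \<subseteq> {W \<in> subspaces_of E. vec.dim W = 2 \<and> \<rho> W = 1}"
    proof
      fix W assume "W \<in> ?Y"
      then obtain F where F: "F \<in> FF" "W \<in> X F" by blast
      then have W: "W \<in> subspaces_of F" "vec.dim W = 2" using X(1) by blast+
      then have "W \<in> subspaces_of E" "W \<subseteq> F" using FF(1)[OF F(1)] by (auto simp: subspaces_of_def)
      then have "\<rho> W \<le> 1" "\<rho> W \<ge> 1" using rk_mono[OF M _ FF(1)[OF F(1)]] FF(2)[OF F(1)] pos W by auto
      then show "W \<in> {W \<in> subspaces_of E. vec.dim W = 2 \<and> \<rho> W = 1}"
        using W \<open>W \<in> subspaces_of E\<close> by simp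
    qed
  next
    fix W assume W: "W \<in> subspaces_of E" "vec.dim W = 2" "\<rho> W = 1"
    have "\<not> W \<subseteq> {0}" using W(2) vec.dim_eq_0[of W] by auto
    then obtain x where x: "x \<in> W" "x \<noteq> 0" by blast
    then have xE: "x \<in> E - {0}" using W by (auto simp: subspaces_of_def)
    then have F: "cl x \<in> FF" by (simp add: FF_def)
    have sub: "W \<subseteq> cl x" using cl_max[OF xE W(1) x(1) W(3)] .
    \<comment> \<open>The flat contains a line, so it is not one of the one-dimensional flats, whose
      stars are empty.\<close>
    then have "2 \<le> vec.dim (cl x)" using W(2) vec.dim_subset by metis
    then have "W \<subseteq> vec.span (\<Union>(X (cl x)))" using X(3)[OF F] sub by blast
    then show "\<exists>b S. b \<noteq> 0 \<and> S \<subseteq> ?Y \<and> (\<forall>U\<in>S. b \<in> U) \<and> W \<subseteq> vec.span (\<Union>S)"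
      using F X(1)[OF F] b[OF F] by (intro exI[of _ "b (cl x)"] exI[of _ "X (cl x)"]) auto
  qed
  moreover have "card ?Y * (q\<^sup>2 - 1) \<le> q ^ vec.dim E - 1"
  proof -
    have "card ?Y * (q\<^sup>2 - 1) \<le> (\<Sum>F\<in>FF. card (X F)) * (q\<^sup>2 - 1)"
      by (intro mult_right_mono card_UN_le) simp_all
    also have "\<dots> = (\<Sum>F\<in>FF. card (X F) * (q\<^sup>2 - 1))" by (simp add: sum_distrib_right)
    also have "\<dots> \<le> (\<Sum>F\<in>FF. card (F - {0}))"
    proof (rule sum_mono)
      fix F assume F: "F \<in> FF"
      have sF: "vec.subspace F" using FF(1)[OF F] by (rule subspaces_ofD)
      have "card (X F) \<le> vec.dim F - 1" "vec.dim F \<ge> 1" using X(2)[OF F] by simp_all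
      then have "card (X F) * (q\<^sup>2 - 1) \<le> (vec.dim F - 1) * (q\<^sup>2 - 1)" by (intro mult_right_mono) simp_all
      also have "\<dots> \<le> q ^ vec.dim F - 1"
        using pred_mult_le_power_minus_one[OF q \<open>vec.dim F \<ge> 1\<close>] .
      finally show "card (X F) * (q\<^sup>2 - 1) \<le> card (F - {0})"
        using card_subspace[OF sF] vec.subspace_0[OF sF] by (simp add: card_Diff_singleton q_def)
    qed
    also have "\<dots> = card (\<Union>F\<in>FF. F - {0})"
    proof (rule card_UN_disjoint[symmetric]; (intro ballI impI)?)
      fix F G assume FG: "F \<in> FF" "G \<in> FF" "F \<noteq> G"
      have "cl y = H" if "H \<in> FF" "y \<in> H - {0}" for y H
        using that cl_eq by (auto simp: FF_def)
      then show "(F - {0}) \<inter> (G - {0}) = {}" using FG by blast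
    qed simp_all
    also have "\<dots> \<le> card (E - {0})"
      using FF(1) by (intro card_mono) (auto simp: subspaces_of_def)
    also have "\<dots> = q ^ vec.dim E - 1"
      using card_subspace[OF E] vec.subspace_0[OF E] by (simp add: card_Diff_singleton q_def)
    finally show ?thesis .
  qed
  ultimately show ?thesis using that by blast
qed

text \<open>The code is read in two ways: for \<open>\<sigma>\<close> it generates the nonbases, for
  \<open>\<rho>\<close> its members have rank one. A basis of \<open>\<rho>\<close> that is a
  nonbasis of \<open>\<sigma>\<close> would then lie in a \<open>\<rho>\<close>-closure of rank
  one.\<close>

lemma rk_le_of_generates_nonbases:
  assumes M: "q_matroid E \<rho>" "loopless E \<rho>" "\<rho> E = 2" "q_matroid E \<sigma>" "loopless E \<sigma>"
    and X: "generates_nonbases E \<rho> X" "generates_nonbases E \<sigma> X"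
    and V: "V \<in> subspaces_of E"
  shows "\<rho> V \<le> \<sigma> V"
proof (rule rk_le_of_bases[OF M(1,4) _ V])
  fix B assume B: "B \<in> subspaces_of E" "vec.dim B = \<rho> E" "\<rho> B = \<rho> E"
  have nz: "\<not> B \<subseteq> {0}" using B(2) M(3) vec.dim_eq_0[of B] by auto
  \<comment> \<open>Looplessness leaves one as the only rank below two to be excluded.\<close>
  then have ge: "\<sigma> B \<ge> 1" using loopless_pos[OF M(4,5) B(1)] by blast
  have "\<sigma> B \<noteq> 1"
  proof
    assume "\<sigma> B = 1"
    then obtain b S where bS: "b \<noteq> 0" "S \<subseteq> X" "\<forall>U\<in>S. b \<in> U" "B \<subseteq> vec.span (\<Union>S)"
      using X(2) B M(3) unfolding generates_nonbases_def by metis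
    have S: "U \<in> subspaces_of E" "\<rho> U = 1" if "U \<in> S" for U
      using X(1) bS(2) that unfolding generates_nonbases_def by blast+
    \<comment> \<open>An empty \<open>S\<close> would span only zero; a member of \<open>S\<close>
      is what places \<open>b\<close> in \<open>E\<close>.\<close>
    have "S \<noteq> {}" using bS(4) nz by auto
    then have bE: "b \<in> E" using bS(3) S(1) by (auto simp: subspaces_of_def)
    note sp = loopless_span[OF M(1,2) bE bS(1)]
    obtain V where V: "V \<in> subspaces_of E" "vec.span {b} \<subseteq> V" "\<rho> V = \<rho> (vec.span {b})"
      "\<And>W. W \<in> subspaces_of E \<Longrightarrow> vec.span {b} \<subseteq> W \<Longrightarrow> \<rho> W = \<rho> (vec.span {b}) \<Longrightarrow> W \<subseteq> V"
      using closure_exists[OF M(1) sp(1)] by blast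
    have "U \<subseteq> V" if "U \<in> S" for U
      using V(4)[OF S(1)[OF that]] S[OF that] sp(2) bS(3) that vec.span_minimal[of "{b}" U]
      by (simp add: subspaces_of_def)
    then have "vec.span (\<Union>S) \<subseteq> V" using V(1) by (intro vec.span_minimal) (auto simp: subspaces_of_def)
    then have "\<rho> B \<le> \<rho> V" using rk_mono[OF M(1) B(1) V(1)] bS(4) by blast
    then show False using V(3) sp(2) B M(3) by simp
  qed
  then show "\<sigma> B = \<rho> E" using rk_le_dim[OF M(4) B(1)] ge B M(3) by simp
qed

section \<open>Arithmetic of q-brackets and the rank-two bound\<close>

context
  fixes q :: nat
  assumes q: "q \<ge> 2"
begin

lemma q_bracket_Suc: "q_bracket q (Suc k) = q * q_bracket q k + 1"
  using q by (simp add: q_bracket_def field_simps)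

text \<open>The form of the recursion that makes the exponents add up in
  \<open>rank2_bound_step\<close>.\<close>

lemma q_bracket_Suc_add: "q_bracket q (Suc k) = q_bracket q k + real q ^ k"
  using q by (simp add: q_bracket_def field_simps)

lemma power_minus_1_eq: "real q ^ k - 1 = (real q - 1) * q_bracket q k"
  using q by (simp add: q_bracket_def)

lemma q_bracket_1: "q_bracket q 1 = 1"
  using q by (simp add: q_bracket_def)

lemma q_bracket_2: "q_bracket q 2 = real q + 1"
  using q_bracket_Suc[of 1] q_bracket_1 by (simp add: numeral_2_eq_2)

lemma q_bracket_ge_1:
  assumes "k \<ge> 1"
  shows "q_bracket q k \<ge> 1"
proof -
  obtain j where j: "k = Suc j" using assms by (cases k) auto
  have "real q ^ j \<ge> 1" using q by simp
  then have "q_bracket q j \<ge> 0" using q unfolding q_bracket_def by (intro divide_nonneg_nonneg) auto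
  then show ?thesis unfolding j q_bracket_Suc by simp
qed

lemma q_bracket_mono: "k \<le> l \<Longrightarrow> q_bracket q k \<le> q_bracket q l"
  using q by (simp add: q_bracket_def divide_right_mono)

end

lemma card_points_q_bracket:
  fixes E :: "('a::{field,finite}^'n) set"
  assumes "vec.subspace E"
  shows "real (card {p \<in> subspaces_of E. vec.dim p = 1}) = q_bracket CARD('a) (vec.dim E)"
proof -
  have q: "CARD('a) \<ge> 2" by (rule card_field_ge_2)
  have "real (card {p \<in> subspaces_of E. vec.dim p = 1} * (CARD('a) - 1)) = real (CARD('a) ^ vec.dim E - 1)"
    using card_points[OF assms] by simp
  then show ?thesis using q by (simp add: q_bracket_def of_nat_diff field_simps)
qed

text \<open>The Gaussian binomial with lower index two, obtained from \<open>card_lines\<close> by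
  cancelling \<open>q * (q - 1) ^ 2\<close>. Writing the dimension as \<open>Suc d\<close> keeps
  subtraction out of the indices.\<close>

lemma card_lines_q_bracket:
  fixes E :: "('a::{field,finite}^'n) set"
  assumes "vec.subspace E" "vec.dim E = Suc d"
  defines "q \<equiv> CARD('a)"
  shows "real (card {W \<in> subspaces_of E. vec.dim W = 2}) = q_bracket q (Suc d) * q_bracket q d / q_bracket q 2"
proof -
  have q: "q \<ge> 2" unfolding q_def by (rule card_field_ge_2)
  let ?c = "card {W \<in> subspaces_of E. vec.dim W = 2}"
  \<comment> \<open>These let natural subtraction be carried over to the reals.\<close>
  have le: "q \<le> q ^ Suc d" "q \<le> q\<^sup>2" "1 \<le> q ^ Suc d" "1 \<le> q\<^sup>2" 
    using q by (simp_all add: power2_eq_square)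
  have "real (?c * ((q\<^sup>2 - 1) * (q\<^sup>2 - q))) = real ((q ^ Suc d - 1) * (q ^ Suc d - q))"
    using card_lines[OF assms(1)] assms(2) by (simp add: q_def)
  then have "?c * ((real q ^ 2 - 1) * (real q ^ 2 - q)) = (real q ^ Suc d - 1) * (real q ^ Suc d - q)"
    using le by (simp only: of_nat_mult of_nat_diff of_nat_power of_nat_1)
  moreover have "(real q ^ 2 - 1) * (real q ^ 2 - q) = q * (real q - 1) ^ 2 * q_bracket q 2"
    by (simp add: q_bracket_2[OF q] power2_eq_square algebra_simps)
  moreover have "(real q ^ Suc d - 1) * (real q ^ Suc d - q)
     = q * (real q - 1) ^ 2 * (q_bracket q (Suc d) * q_bracket q d)"
  proof -
    have "real q ^ Suc d - q = q * (real q ^ d - 1)" by (simp add: algebra_simps)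
    then show ?thesis by (simp only: power_minus_1_eq[OF q] power2_eq_square mult.assoc mult.left_commute)
  qed
  ultimately have "q * (real q - 1) ^ 2 * (?c * q_bracket q 2)
     = q * (real q - 1) ^ 2 * (q_bracket q (Suc d) * q_bracket q d)"
    by (simp only: mult.left_commute mult.commute mult.assoc)
  then have "?c * q_bracket q 2 = q_bracket q (Suc d) * q_bracket q d" using q by simp
  moreover have "q_bracket q 2 > 0" using q_bracket_ge_1[OF q, of 2] by simp
  ultimately show ?thesis by (simp add: field_simps)
qed

text \<open>The bound for the number of codes in dimension \<open>m\<close>: the exponent is the
  maximal size of a code, and the base is e times the number of lines divided by that size.\<close>

definition rank2_bound :: "nat \<Rightarrow> nat \<Rightarrow> real" where
  "rank2_bound q m = (exp 1 * q_bracket q (m - 1)) powr (q_bracket q m / q_bracket q 2)"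

lemma card_loopless_le:
  fixes E :: "('a::{field,finite}^'n) set"
  assumes E: "vec.subspace E" "vec.dim E \<ge> 2"
  shows "real (card {\<rho>. q_matroid E \<rho> \<and> \<rho> E = 2 \<and> loopless E \<rho>}) \<le> rank2_bound CARD('a) (vec.dim E)"
proof -
  define q where "q = CARD('a)"
  have q: "q \<ge> 2" unfolding q_def by (rule card_field_ge_2)
  obtain d where d: "vec.dim E = Suc d" "d \<ge> 1" using E(2) by (cases "vec.dim E") auto
  let ?R = "{\<rho>. q_matroid E \<rho> \<and> \<rho> E = 2 \<and> loopless E \<rho>}"
  let ?L = "{W \<in> subspaces_of E. vec.dim W = 2}"
  define \<kappa> where "\<kappa> = q_bracket q (Suc d) / q_bracket q 2"
  \<comment> \<open>The optimal weight \<open>\<kappa> / card ?L\<close>, which simplifies to this;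
    hence \<open>t * card ?L = \<kappa>\<close> below.\<close>
  define t where "t = 1 / q_bracket q d"
  have br: "q_bracket q d \<ge> 1" "q_bracket q 2 \<ge> 1" using q_bracket_ge_1[OF q] d(2) by simp_all
  have t: "0 < t" "t \<le> 1" using br by (simp_all add: t_def)
  have "\<exists>X. generates_nonbases E \<rho> X \<and> X \<in> {X \<in> Pow ?L. real (card X) \<le> \<kappa>}" if "\<rho> \<in> ?R" for \<rho>
  proof -
    have "q_matroid E \<rho>" "loopless E \<rho>" using that by simp_all
    then obtain X where X: "generates_nonbases E \<rho> X" "card X * (q\<^sup>2 - 1) \<le> q ^ Suc d - 1"
      unfolding q_def d(1)[symmetric] by (rule generates_nonbases_exists)
    have "1 \<le> q ^ Suc d" "1 \<le> q\<^sup>2" using q by simp_all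
    then have "card X * (real q ^ 2 - 1) \<le> real q ^ Suc d - 1"
      using of_nat_mono[OF X(2), where 'a = real] by (simp only: of_nat_mult of_nat_diff of_nat_power of_nat_1)
    then have "(real q - 1) * (card X * q_bracket q 2) \<le> (real q - 1) * q_bracket q (Suc d)"
      by (simp only: power_minus_1_eq[OF q] mult.left_commute)
    then have "card X * q_bracket q 2 \<le> q_bracket q (Suc d)" using q by simp
    then have "card X \<le> \<kappa>" using br by (simp add: \<kappa>_def field_simps)
    then show ?thesis using X(1) unfolding generates_nonbases_def by blast
  qed
  then have "\<forall>\<rho>\<in>?R. \<exists>X. generates_nonbases E \<rho> X \<and> X \<in> {X \<in> Pow ?L. real (card X) \<le> \<kappa>}"
    by blast
  from bchoice[OF this] obtain code where
    "\<forall>\<rho>\<in>?R. generates_nonbases E \<rho> (code \<rho>) \<and> code \<rho> \<in> {X \<in> Pow ?L. real (card X) \<le> \<kappa>}" ..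
  then have code: "generates_nonbases E \<rho> (code \<rho>)"
      "code \<rho> \<in> {X \<in> Pow ?L. real (card X) \<le> \<kappa>}" if "\<rho> \<in> ?R" for \<rho>
    using that by blast+
  have "card ?R \<le> card {X \<in> Pow ?L. real (card X) \<le> \<kappa>}"
  proof (rule card_inj_on_le)
    show "inj_on code ?R"
    proof (rule inj_onI)
      fix \<rho> \<sigma> assume \<rho>: "\<rho> \<in> ?R" and \<sigma>: "\<sigma> \<in> ?R" and eq: "code \<rho> = code \<sigma>"
      then show "\<rho> = \<sigma>"
        using rk_le_of_generates_nonbases[of E \<rho> \<sigma> "code \<rho>"] rk_le_of_generates_nonbases[of E \<sigma> \<rho> "code \<rho>"]
          code(1)[OF \<rho>] code(1)[OF \<sigma>]
        by (intro q_matroid_eqI[of E] antisym) auto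
    qed
    show "code ` ?R \<subseteq> {X \<in> Pow ?L. real (card X) \<le> \<kappa>}" using code(2) by blast
  qed simp
  then have "real (card ?R) \<le> exp (t * card ?L) * t powr (- \<kappa>)"
    using card_small_subsets_le[of ?L t \<kappa>] t by simp
  also have "t * card ?L = \<kappa>"
    using card_lines_q_bracket[OF E(1) d(1)] br by (simp add: t_def \<kappa>_def q_def)
  also have "t powr (- \<kappa>) = q_bracket q d powr \<kappa>"
    using br by (simp add: t_def powr_minus powr_divide)
  also have "exp \<kappa> * q_bracket q d powr \<kappa> = rank2_bound q (Suc d)"
  proof -
    have "exp \<kappa> = exp 1 powr \<kappa>" by (simp add: powr_def)
    then show ?thesis using br by (simp only: rank2_bound_def \<kappa>_def diff_Suc_1 powr_mult[of "exp 1"])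
  qed
  finally show ?thesis by (simp add: q_def d(1))
qed

text \<open>The factor on the left pays for the choice of a loop. Once the base of
  \<open>rank2_bound q d\<close> is enlarged to \<open>exp 1 * z\<close>, both bounds are powers of
  the same number, and it remains to fit \<open>q_bracket q (Suc d)\<close> into the power with
  exponent \<open>q ^ d / (q + 1)\<close>.\<close>

lemma rank2_bound_step:
  assumes q: "q \<ge> 2" and d: "d \<ge> 2"
  shows "q_bracket q (Suc d) * rank2_bound q d \<le> rank2_bound q (Suc d)"
proof -
  define z where "z = q_bracket q d"
  have q2: "q_bracket q 2 = real q + 1" using q_bracket_2[OF q] by simp
  have z: "z \<ge> real q + 1" using q_bracket_mono[OF q d] q2 by (simp add: z_def)
  \<comment> \<open>\<open>5 / 2\<close> is \<open>1 + 1 + 1 / 2\<close>; it gives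
    \<open>2 * z + 1 \<le> exp 1 * z\<close> once \<open>z \<ge> 3\<close>.\<close>
  have e: "exp (1::real) \<ge> 5 / 2" using exp_lower_Taylor_quadratic[of 1] by simp
  have "1 * z \<le> exp 1 * z" using e z q by (intro mult_right_mono) auto
  then have ez: "z \<le> exp 1 * z" by simp
  have ez1: "exp 1 * z \<ge> 1" using ez z q by linarith
  have exponent: "real q ^ d / (real q + 1) \<ge> real q ^ 2 / (real q + 1)"
    using q d by (intro divide_right_mono power_increasing) auto
  have "q_bracket q (Suc d) \<le> (exp 1 * z) powr (real q ^ d / (real q + 1))"
  \<comment> \<open>For \<open>q = d = 2\<close> the exponent is only \<open>4 / 3\<close>, so the
    first power must do and the factor \<open>exp 1\<close> is essential. For
    \<open>q \<ge> 3\<close> the exponent is at least two and the square is available.\<close>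
  proof (cases "q = 2")
    case True
    have "(5 / 2) * z \<le> exp 1 * z" using e z by (intro mult_right_mono) auto
    moreover have "z \<ge> 3" using z True by simp
    moreover have "q_bracket q (Suc d) = 2 * z + 1"
      unfolding q_bracket_Suc[OF q] z_def[symmetric] by (simp add: True)
    ultimately have "q_bracket q (Suc d) \<le> exp 1 * z" by linarith
    also have "\<dots> = (exp 1 * z) powr 1" using ez1 by simp
    also have "\<dots> \<le> (exp 1 * z) powr (real q ^ d / (real q + 1))"
      using exponent ez1 by (intro powr_mono) (auto simp: True)
    finally show ?thesis .
  next
    case False
    then have q3: "real q \<ge> 3" using q by simp
    have "q_bracket q (Suc d) \<le> (real q + 1) * z"
      unfolding q_bracket_Suc[OF q] z_def[symmetric] using z by (simp add: algebra_simps)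
    also have "\<dots> \<le> z * z" using z by (intro mult_right_mono) auto
    also have "\<dots> \<le> (exp 1 * z) * (exp 1 * z)" using ez z by (intro mult_mono) auto
    also have "\<dots> = (exp 1 * z) powr 2" using ez1 by (simp add: powr_numeral power2_eq_square)
    also have "\<dots> \<le> (exp 1 * z) powr (real q ^ d / (real q + 1))"
    proof (rule powr_mono[OF _ ez1])
      have "2 * (real q + 1) \<le> 3 * real q" using q3 by simp
      also have "\<dots> \<le> real q ^ 2" unfolding power2_eq_square using q3 by (intro mult_right_mono) auto
      finally have "2 \<le> real q ^ 2 / (real q + 1)" by (simp add: field_simps)
      then show "2 \<le> real q ^ d / (real q + 1)" using exponent by linarith
    qed
    finally show ?thesis .
  qed
  moreover have "rank2_bound q d \<le> (exp 1 * z) powr (q_bracket q d / (real q + 1))"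
  proof -
    have "q_bracket q (d - 1) \<ge> 1" using q_bracket_ge_1[OF q] d by simp
    moreover have "q_bracket q (d - 1) \<le> z" using q_bracket_mono[OF q, of "d - 1" d] by (simp add: z_def)
    moreover have "q_bracket q d \<ge> 0" using z q by (simp add: z_def)
    ultimately show ?thesis unfolding rank2_bound_def q2 by (intro powr_mono2 mult_left_mono) auto
  qed
  ultimately have "q_bracket q (Suc d) * rank2_bound q d
      \<le> (exp 1 * z) powr (real q ^ d / (real q + 1)) * (exp 1 * z) powr (q_bracket q d / (real q + 1))"
    by (intro mult_mono) (simp_all add: rank2_bound_def)
  also have "\<dots> = rank2_bound q (Suc d)"
    unfolding powr_add[symmetric] add_divide_distrib[symmetric]
    by (simp add: rank2_bound_def q2 z_def q_bracket_Suc_add[OF q] add.commute)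
  finally show ?thesis .
qed

text \<open>Either there is no loop, or one of the points is a loop; the second case is a union
  bound over points with at most \<open>N\<close> q-matroids for each.\<close>

lemma num_rank2_le:
  fixes E :: "('a::{field,finite}^'n) set"
  assumes E: "vec.subspace E"
    and N: "\<And>K. K \<in> subspaces_of E \<Longrightarrow> Suc (vec.dim K) = vec.dim E \<Longrightarrow> num_q_matroids K 2 \<le> N"
  shows "real (num_q_matroids E 2) \<le> real (card {\<rho>. q_matroid E \<rho> \<and> \<rho> E = 2 \<and> loopless E \<rho>})
    + q_bracket CARD('a) (vec.dim E) * N"
proof -
  let ?P = "{p \<in> subspaces_of E. vec.dim p = 1}"
  let ?L = "{\<rho>. q_matroid E \<rho> \<and> \<rho> E = 2 \<and> loopless E \<rho>}"
  let ?Q = "\<lambda>p. {\<rho>. q_matroid E \<rho> \<and> \<rho> E = 2 \<and> \<rho> p = 0}"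
  have "card (\<Union>p\<in>?P. ?Q p) \<le> (\<Sum>p\<in>?P. card (?Q p))" by (rule card_UN_le) simp
  also have "\<dots> \<le> (\<Sum>p\<in>?P. N)"
    using card_loop_le[OF E _ _ N] by (intro sum_mono) blast
  finally have *: "card (\<Union>p\<in>?P. ?Q p) \<le> card ?P * N" by simp
  have "num_q_matroids E 2 \<le> card (?L \<union> (\<Union>p\<in>?P. ?Q p))"
    unfolding num_q_matroids_def
    by (rule card_mono) (auto simp: finite_q_matroids loopless_def)
  also have "\<dots> \<le> card ?L + card (\<Union>p\<in>?P. ?Q p)" by (rule card_Un_le)
  also have "\<dots> \<le> card ?L + card ?P * N" using * by (rule add_left_mono)
  finally have "real (num_q_matroids E 2) \<le> real (card ?L + card ?P * N)" by (rule of_nat_mono)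
  then show ?thesis by (simp only: of_nat_add of_nat_mult card_points_q_bracket[OF E])
qed

text \<open>Each dimension contributes one copy of the loopless bound, and
  \<open>rank2_bound_step\<close> carries the earlier copies along. This is where the factor
  \<open>vec.dim E\<close> comes from.\<close>

lemma num_rank2_Suc_le:
  fixes E :: "('a::{field,finite}^'n) set"
  assumes "vec.subspace E" "vec.dim E \<ge> 2"
  shows "real (num_q_matroids E 2) + 1 \<le> vec.dim E * rank2_bound CARD('a) (vec.dim E)"
proof -
  have q: "CARD('a) \<ge> 2" by (rule card_field_ge_2)
  have "\<forall>E :: ('a^'n) set. vec.subspace E \<longrightarrow> vec.dim E = m \<longrightarrow>
    real (num_q_matroids E 2) + 1 \<le> m * rank2_bound CARD('a) m" if "m \<ge> 2" for m
    using that
  proof (induction m rule: dec_induct)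
    case base
    show ?case
    proof (intro allI impI)
      fix E :: "('a^'n) set" assume E: "vec.subspace E" "vec.dim E = 2"
      \<comment> \<open>In dimension two the contraction by a loop lives on a point, which has no
        room for rank two.\<close>
      have "num_q_matroids K 2 \<le> 0" if K: "K \<in> subspaces_of E" "Suc (vec.dim K) = vec.dim E" for K
      proof -
        have "\<rho> K \<le> 1" if "q_matroid K \<rho>" for \<rho>
          using rk_le_dim[OF that subspaces_of_self] K E by (simp add: subspaces_of_def)
        then have "{\<rho>. q_matroid K \<rho> \<and> \<rho> K = 2} = {}" by fastforce
        then show ?thesis by (simp only: num_q_matroids_def card.empty)
      qed
      then have "real (num_q_matroids E 2) \<le> rank2_bound CARD('a) 2"
        using num_rank2_le[OF E(1), of 0] card_loopless_le[OF E(1)] E(2) by simp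
      moreover have "rank2_bound CARD('a) 2 \<ge> 1"
        using q_bracket_ge_1[OF q, of 2] q_bracket_1[OF q] by (simp add: rank2_bound_def)
      ultimately show "real (num_q_matroids E 2) + 1 \<le> real 2 * rank2_bound CARD('a) 2" by simp
    qed
  next
    case (step d)
    let ?f = "rank2_bound CARD('a)"
    show ?case
    proof (intro allI impI)
      fix E :: "('a^'n) set" assume E: "vec.subspace E" "vec.dim E = Suc d"
      \<comment> \<open>\<open>num_rank2_le\<close> takes a natural number, so the real bound from
        the induction hypothesis is rounded down.\<close>
      define N where "N = nat \<lfloor>d * ?f d - 1\<rfloor>"
      have IH: "real (num_q_matroids K 2) \<le> d * ?f d - 1" if "vec.subspace K" "vec.dim K = d" for K :: "('a^'n) set"
        using step.IH that by fastforce
      have KN: "num_q_matroids K 2 \<le> N" if "K \<in> subspaces_of E" "Suc (vec.dim K) = vec.dim E" for K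
        unfolding N_def by (intro le_nat_floor IH) (use that E(2) in \<open>simp_all add: subspaces_of_def\<close>)
      \<comment> \<open>Some hyperplane is needed to see that the real bound is nonnegative, so that
        \<open>nat\<close> does not raise it.\<close>
      obtain K where K: "K \<in> subspaces_of E" "vec.dim K = d"
        using subspace_of_dim_exists[of d E] E by auto
      have "d * ?f d - 1 \<ge> 0" using IH[of K] K by (simp add: subspaces_of_def order_trans[OF of_nat_0_le_iff])
      then have N: "real N \<le> d * ?f d - 1" by (simp add: N_def)
      have br: "q_bracket CARD('a) (Suc d) \<ge> 1" using q_bracket_ge_1[OF q] by simp
      have "real (num_q_matroids E 2) + 1 \<le> ?f (Suc d) + q_bracket CARD('a) (Suc d) * N + 1"
        using num_rank2_le[OF E(1), of N] KN card_loopless_le[OF E(1)] E(2) step.hyps by simp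
      also have "\<dots> \<le> ?f (Suc d) + q_bracket CARD('a) (Suc d) * (d * ?f d - 1) + 1"
        using N br by (intro add_mono mult_left_mono) auto
      \<comment> \<open>The \<open>- 1\<close> from the induction hypothesis, times a bracket that
        is at least one, absorbs the \<open>+ 1\<close>.\<close>
      also have "\<dots> \<le> ?f (Suc d) + d * (q_bracket CARD('a) (Suc d) * ?f d)"
        using br by (simp add: algebra_simps)
      also have "\<dots> \<le> ?f (Suc d) + d * ?f (Suc d)"
        using rank2_bound_step[OF q step.hyps(1)] by (intro add_left_mono mult_left_mono) auto
      finally show "real (num_q_matroids E 2) + 1 \<le> real (Suc d) * ?f (Suc d)"
        by (simp add: algebra_simps)
    qed
  qed
  then show ?thesis using assms by blast
qed

subsection \<open>Reduction to rank two\<close>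

lemma complement_Int:
  assumes "vec.subspace T" "C \<in> subspaces_of E" "C \<inter> T = {0}" "C \<oplus> T = E"
    and V: "V \<in> subspaces_of E" "T \<subseteq> V"
  shows "V \<inter> C \<in> subspaces_of C" "(V \<inter> C) \<oplus> T = V" "vec.dim V = vec.dim (V \<inter> C) + vec.dim T"
proof -
  show *: "V \<inter> C \<in> subspaces_of C" using assms by (simp add: subspaces_of_def vec.subspace_inter)
  show **: "(V \<inter> C) \<oplus> T = V" using sum_Int_complement[of V T C E] assms by (simp add: subspaces_of_def)
  have "(V \<inter> C) \<inter> T = {0}"
    using assms(3) vec.subspace_0[OF subspaces_ofD(1)[OF V(1)]] by blast
  then show "vec.dim V = vec.dim (V \<inter> C) + vec.dim T"
    using dim_sum[OF subspaces_ofD(1)[OF *] assms(1)] ** by simp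
qed

text \<open>The correspondence theorem for the quotient by \<open>T\<close>, with the complement
  \<open>C\<close> in place of the quotient.\<close>

lemma card_superspaces:
  assumes E: "vec.subspace E" and T: "T \<in> subspaces_of E"
    and C: "C \<in> subspaces_of E" "C \<inter> T = {0}" "C \<oplus> T = E"
  shows "card {V \<in> subspaces_of E. vec.dim V = k + vec.dim T \<and> T \<subseteq> V}
    = card {W \<in> subspaces_of C. vec.dim W = k}"
proof (rule bij_betw_same_card[of "\<lambda>V. V \<inter> C"], rule bij_betw_byWitness[where f' = "\<lambda>W. W \<oplus> T"])
  let ?A = "{V \<in> subspaces_of E. vec.dim V = k + vec.dim T \<and> T \<subseteq> V}"
  let ?B = "{W \<in> subspaces_of C. vec.dim W = k}"
  have sT: "vec.subspace T" using T by (simp add: subspaces_of_def)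
  note cI = complement_Int[OF sT C]
  show "\<forall>V\<in>?A. (V \<inter> C) \<oplus> T = V" using cI by blast
  show "(\<lambda>V. V \<inter> C) ` ?A \<subseteq> ?B" using cI by fastforce
  have WT: "W \<oplus> T \<in> subspaces_of E" "vec.dim (W \<oplus> T) = vec.dim W + vec.dim T" "T \<subseteq> W \<oplus> T"
    if "W \<in> subspaces_of C" for W
  proof -
    have W: "vec.subspace W" "W \<subseteq> C" "W \<in> subspaces_of E"
      using that C(1) by (auto simp: subspaces_of_def)
    show "W \<oplus> T \<in> subspaces_of E" using subspaces_of_sum[OF E W(3) T] .
    have "W \<inter> T = {0}" using W C(2) vec.subspace_0[OF W(1)] vec.subspace_0[OF sT] by blast
    then show "vec.dim (W \<oplus> T) = vec.dim W + vec.dim T" using dim_sum[OF W(1) sT] by simp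
    show "T \<subseteq> W \<oplus> T" using sum_upper2[OF W(1)] .
  qed
  show "(\<lambda>W. W \<oplus> T) ` ?B \<subseteq> ?A" using WT by auto
  show "\<forall>W\<in>?B. (W \<oplus> T) \<inter> C = W"
  proof
    fix W assume "W \<in> ?B"
    then have W: "W \<in> subspaces_of C" by simp
    \<comment> \<open>One inclusion suffices, as the dimensions then force equality.\<close>
    have sub: "W \<subseteq> (W \<oplus> T) \<inter> C" using sum_upper1[OF sT, of W] subspaces_ofD[OF W] by blast
    have "vec.dim ((W \<oplus> T) \<inter> C) \<le> vec.dim W" using cI(3)[OF WT(1,3)[OF W]] WT(2)[OF W] by simp
    then show "(W \<oplus> T) \<inter> C = W"
      using vec.subspace_dim_equal[OF subspaces_ofD(1)[OF W] subspaces_ofD(1)[OF cI(1)[OF WT(1,3)[OF W]]] sub]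
      by simp
  qed
qed

section \<open>Families of bases and their traces\<close>

definition bases_of :: "('a::{field,finite}^'n) set \<Rightarrow> (('a^'n) set \<Rightarrow> nat) \<Rightarrow> ('a^'n) set set" where
  "bases_of E \<rho> = {B \<in> subspaces_of E. vec.dim B = \<rho> E \<and> \<rho> B = \<rho> E}"

lemma inj_on_bases_of: "inj_on (bases_of E) {\<rho>. q_matroid E \<rho> \<and> \<rho> E = r}"
proof (rule inj_onI)
  fix \<rho> \<sigma> assume "\<rho> \<in> {\<rho>. q_matroid E \<rho> \<and> \<rho> E = r}" "\<sigma> \<in> {\<rho>. q_matroid E \<rho> \<and> \<rho> E = r}"
    and eq: "bases_of E \<rho> = bases_of E \<sigma>"
  then have M: "q_matroid E \<rho>" "\<rho> E = r" "q_matroid E \<sigma>" "\<sigma> E = r" by auto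
  have iff: "\<rho> B = r \<longleftrightarrow> \<sigma> B = r" if "B \<in> subspaces_of E" "vec.dim B = r" for B
    using eq that M unfolding bases_of_def by auto
  have "\<rho> V \<le> \<sigma> V" if "V \<in> subspaces_of E" for V
    by (rule rk_le_of_bases[OF M(1,3) _ that]) (simp add: iff M(2))
  moreover have "\<sigma> V \<le> \<rho> V" if "V \<in> subspaces_of E" for V
    by (rule rk_le_of_bases[OF M(3,1) _ that]) (simp add: iff M(4))
  ultimately show "\<rho> = \<sigma>" by (intro q_matroid_eqI[OF M(1,3)] antisym)
qed

text \<open>Every q-matroid has a basis, so the empty family is new. It accounts for the
  \<open>+ 1\<close> inside the logarithm of the theorem.\<close>

lemma card_bases_of:
  "card (insert {} (bases_of E ` {\<rho>. q_matroid E \<rho> \<and> \<rho> E = r})) = num_q_matroids E r + 1"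
proof -
  have "{} \<notin> bases_of E ` {\<rho>. q_matroid E \<rho> \<and> \<rho> E = r}"
  proof
    assume "{} \<in> bases_of E ` {\<rho>. q_matroid E \<rho> \<and> \<rho> E = r}"
    then obtain \<rho> where "q_matroid E \<rho>" "bases_of E \<rho> = {}" by auto
    then show False using basis_exists[of E \<rho>] unfolding bases_of_def by blast
  qed
  then show ?thesis
    using card_image[OF inj_on_bases_of] by (simp add: finite_q_matroids num_q_matroids_def)
qed

text \<open>The trace of the adjoined empty family is also the trace at a dependent
  \<open>T\<close>, so a single extra value covers both.\<close>

lemma card_bases_above_le:
  fixes E :: "('a::{field,finite}^'n) set" and k :: nat
  assumes E: "vec.subspace E" and T: "T \<in> subspaces_of E"
    and C: "C \<in> subspaces_of E" "C \<inter> T = {0}" "C \<oplus> T = E"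
  defines "r \<equiv> k + vec.dim T"
  shows "card ((\<lambda>X. X \<inter> {V. T \<subseteq> V}) ` insert {} (bases_of E ` {\<rho>. q_matroid E \<rho> \<and> \<rho> E = r}))
    \<le> num_q_matroids C k + 1"
proof -
  let ?R = "{\<rho>. q_matroid C \<rho> \<and> \<rho> C = k}"
  \<comment> \<open>The bases of \<open>\<sigma>\<close> lifted by adding \<open>T\<close>, written
    in terms of \<open>V\<close>.\<close>
  define g where "g \<sigma> = {V \<in> subspaces_of E. vec.dim V = r \<and> \<sigma> (V \<inter> C) = k \<and> T \<subseteq> V}" for \<sigma> :: "('a^'n) set \<Rightarrow> nat"
  have sT: "vec.subspace T" using T by (simp add: subspaces_of_def)
  note cI = complement_Int[OF sT C]
  have "X \<inter> {V. T \<subseteq> V} \<in> insert {} (g ` ?R)"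
    if X: "X \<in> insert {} (bases_of E ` {\<rho>. q_matroid E \<rho> \<and> \<rho> E = r})" for X
  proof (cases "X = {}")
    case False
    then obtain \<rho> where \<rho>: "q_matroid E \<rho>" "\<rho> E = r" "X = bases_of E \<rho>" using X by blast
    have split: "\<rho> ((V \<inter> C) \<oplus> T) = \<rho> V" "vec.dim (V \<inter> C) = k" "V \<inter> C \<in> subspaces_of C"
      "V \<inter> C \<in> subspaces_of E" if "V \<in> subspaces_of E" "vec.dim V = r" "T \<subseteq> V" for V
      using cI[OF that(1,3)] that(2) C(1) by (auto simp: r_def subspaces_of_def)
    show ?thesis
    proof (cases "\<rho> T = vec.dim T")
      case True
      define \<sigma> where "\<sigma> = restrict (\<lambda>W. \<rho> (W \<oplus> T) - \<rho> T) (subspaces_of C)"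
      have "C \<in> subspaces_of C" using C(1) by (simp add: subspaces_of_def)
      then have "\<sigma> \<in> ?R" using contraction[OF \<rho>(1) T C(1)] C(3) \<rho>(2) True by (simp add: \<sigma>_def r_def)
      moreover have "X \<inter> {V. T \<subseteq> V} = g \<sigma>"
      proof -
        have "\<sigma> (V \<inter> C) = k \<longleftrightarrow> \<rho> V = r" if "V \<in> subspaces_of E" "vec.dim V = r" "T \<subseteq> V" for V
        proof -
          have "\<sigma> (V \<inter> C) = \<rho> V - vec.dim T" using split[OF that] True by (simp add: \<sigma>_def)
          moreover have "\<rho> V \<ge> vec.dim T" using rk_mono[OF \<rho>(1) T that(1,3)] True by simp
          ultimately show ?thesis by (auto simp: r_def)
        qed
        then show ?thesis by (auto simp: \<rho>(2,3) bases_of_def g_def)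
      qed
      ultimately show ?thesis by blast
    next
      case False
      then have lt: "\<rho> T < vec.dim T" using rk_le_dim[OF \<rho>(1) T] by simp
      \<comment> \<open>\<open>V = (V \<inter> C) \<oplus> T\<close> has rank at most
        \<open>k + \<rho> T\<close>, which is less than \<open>r\<close>.\<close>
      have "\<rho> V \<noteq> r" if V: "V \<in> subspaces_of E" "vec.dim V = r" "T \<subseteq> V" for V
        using rk_sum_le[OF \<rho>(1) split(4)[OF V] T] split[OF V] rk_le_dim[OF \<rho>(1) split(4)[OF V]] lt
        by (simp add: r_def)
      then have "X \<inter> {V. T \<subseteq> V} = {}" by (auto simp: \<rho>(2,3) bases_of_def)
      then show ?thesis by blast
    qed
  qed simp
  then have "card ((\<lambda>X. X \<inter> {V. T \<subseteq> V}) ` insert {} (bases_of E ` {\<rho>. q_matroid E \<rho> \<and> \<rho> E = r}))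
    \<le> card (insert {} (g ` ?R))"
    by (intro card_mono finite.insertI finite_imageI finite_q_matroids) blast
  also have "\<dots> \<le> card (g ` ?R) + 1" by (simp add: card_insert_if finite_q_matroids)
  also have "card (g ` ?R) \<le> card ?R" by (rule card_image_le) (rule finite_q_matroids)
  finally show ?thesis by (simp add: num_q_matroids_def)
qed

text \<open>Shearer's inequality bounds the \<open>d\<close>-th power of the number of families by
  \<open>y ^ card ?I\<close>, where each r-space contains \<open>d\<close> of the t-spaces in
  \<open>?I\<close>. Counting incident pairs replaces the ratio \<open>card ?I / d\<close> by
  \<open>card ?S / c\<close>.\<close>

lemma ln_num_q_matroids_le:
  fixes E :: "('a::{field,finite}^'n) set"
  assumes E: "vec.subspace E" "k + t \<le> vec.dim E"
    and bound: "\<And>C. C \<in> subspaces_of E \<Longrightarrow> vec.dim C + t = vec.dim E \<Longrightarrow>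
        real (num_q_matroids C k) + 1 \<le> y \<and> real (card {W \<in> subspaces_of C. vec.dim W = k}) = c"
  shows "c * ln (real (num_q_matroids E (k + t)) + 1) \<le> gaussian_binomial E (k + t) * ln y"
proof -
  define r where "r = k + t"
  let ?S = "{V \<in> subspaces_of E. vec.dim V = r}"
  let ?I = "{T \<in> subspaces_of E. vec.dim T = t}"
  let ?F = "insert {} (bases_of E ` {\<rho>. q_matroid E \<rho> \<and> \<rho> E = r})"
  have compl: "\<exists>C. C \<in> subspaces_of E \<and> C \<inter> T = {0} \<and> C \<oplus> T = E \<and> vec.dim C + t = vec.dim E"
    if "T \<in> ?I" for T
  proof -
    have T: "vec.subspace T" "T \<subseteq> E" "vec.dim T = t" using that by (simp_all add: subspaces_of_def)
    then show ?thesis using complement_exists[OF T(1) E(1) T(2)] by metis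
  qed
  obtain V0 where V0: "V0 \<in> ?S" using subspace_of_dim_exists[OF E(2,1)] by (auto simp: r_def)
  \<comment> \<open>\<open>V0\<close> is only a reference: all r-spaces contain equally many
    t-spaces.\<close>
  define d where "d = card {T \<in> subspaces_of V0. vec.dim T = t}"
  have cover: "card {T \<in> ?I. V \<in> {V. T \<subseteq> V}} = d" if "V \<in> ?S" for V
  proof -
    have "{T \<in> ?I. V \<in> {V. T \<subseteq> V}} = {T \<in> subspaces_of V. vec.dim T = t}"
      using that by (auto simp: subspaces_of_def)
    then show ?thesis
      using card_subspaces_of_dim_cong[of V V0 t] that V0 by (simp add: d_def subspaces_of_def)
  qed
  have "d > 0"
  proof -
    have "t \<le> vec.dim V0" "vec.subspace V0" using V0 by (simp_all add: r_def subspaces_of_def)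
    then obtain T where "T \<in> subspaces_of V0" "vec.dim T = t" using subspace_of_dim_exists by metis
    then show ?thesis by (auto simp: d_def card_gt_0_iff)
  qed
  have Shearer: "card ?F ^ d \<le> (\<Prod>T\<in>?I. card ((\<lambda>X. X \<inter> {V. T \<subseteq> V}) ` ?F))"
    by (rule Shearer_card[of ?S]) (use cover \<open>d > 0\<close> in \<open>auto simp: bases_of_def\<close>)
  have trace: "real (card ((\<lambda>X. X \<inter> {V. T \<subseteq> V}) ` ?F)) \<le> y" if T: "T \<in> ?I" for T
  proof -
    obtain C where C: "C \<in> subspaces_of E" "C \<inter> T = {0}" "C \<oplus> T = E" "vec.dim C + t = vec.dim E"
      using compl[OF T] by blast
    have "card ((\<lambda>X. X \<inter> {V. T \<subseteq> V}) ` ?F) \<le> num_q_matroids C k + 1"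
      using card_bases_above_le[OF E(1) _ C(1-3), where k = k] T by (simp add: r_def)
    then show ?thesis using bound[OF C(1,4)] by linarith
  qed
  have "real (card ?F) ^ d \<le> (\<Prod>T\<in>?I. real (card ((\<lambda>X. X \<inter> {V. T \<subseteq> V}) ` ?F)))"
    using of_nat_mono[OF Shearer, where 'a = real] by (simp only: of_nat_power of_nat_prod)
  also have "\<dots> \<le> (\<Prod>T\<in>?I. y)" by (intro prod_mono conjI trace) simp_all
  finally have pow: "real (card ?F) ^ d \<le> y ^ card ?I" by simp
  have F: "real (card ?F) = real (num_q_matroids E r) + 1" using card_bases_of[of E r] by simp
  \<comment> \<open>A single complement suffices to read off \<open>y \<ge> 1\<close> and
    \<open>c \<ge> 0\<close> from \<open>bound\<close>.\<close>
  obtain T0 where "T0 \<in> ?I" using subspace_of_dim_exists[of t E] E by auto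
  then obtain C0 where "C0 \<in> subspaces_of E" "vec.dim C0 + t = vec.dim E" using compl by blast
  then have y: "y \<ge> 1" and c: "c \<ge> 0" using bound[of C0] by auto
  have "ln (real (card ?F) ^ d) \<le> ln (y ^ card ?I)"
    using pow y F by (subst ln_le_cancel_iff) auto
  then have le: "d * ln (real (num_q_matroids E r) + 1) \<le> card ?I * ln y"
    using y by (simp add: ln_realpow F)
  have double: "d * real (card ?S) = card ?I * c"
  proof -
    have "d * card ?S = (\<Sum>V\<in>?S. card {T \<in> ?I. T \<subseteq> V})" using cover by simp
    also have "\<dots> = (\<Sum>T\<in>?I. card {V \<in> ?S. T \<subseteq> V})"
      using sum_multicount_gen[of ?S ?I "\<lambda>V T. T \<subseteq> V" "\<lambda>T. card {V \<in> ?S. T \<subseteq> V}"] by simp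
    finally have "real (d * card ?S) = real (\<Sum>T\<in>?I. card {V \<in> ?S. T \<subseteq> V})" by (rule arg_cong)
    then have "d * real (card ?S) = (\<Sum>T\<in>?I. real (card {V \<in> ?S. T \<subseteq> V}))"
      by (simp only: of_nat_mult of_nat_sum)
    also have "\<dots> = (\<Sum>T\<in>?I. c)"
    proof (rule sum.cong)
      fix T assume T: "T \<in> ?I"
      obtain C where C: "C \<in> subspaces_of E" "C \<inter> T = {0}" "C \<oplus> T = E" "vec.dim C + t = vec.dim E"
        using compl[OF T] by blast
      have "{V \<in> ?S. T \<subseteq> V} = {V \<in> subspaces_of E. vec.dim V = k + vec.dim T \<and> T \<subseteq> V}"
        using T by (auto simp: r_def)
      then show "real (card {V \<in> ?S. T \<subseteq> V}) = c"
        using card_superspaces[OF E(1) _ C(1-3), where k = k] T bound[OF C(1,4)] by simp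
    qed simp
    finally show ?thesis by simp
  qed
  have "d * (c * ln (real (num_q_matroids E r) + 1)) \<le> c * (card ?I * ln y)"
    using mult_left_mono[OF le c] by (simp add: mult.left_commute)
  also have "\<dots> = d * (card ?S * ln y)" using double by (simp add: mult.assoc[symmetric] mult.commute)
  finally have "c * ln (real (num_q_matroids E r) + 1) \<le> card ?S * ln y"
    using \<open>d > 0\<close> by simp
  then show ?thesis by (simp add: gaussian_binomial_def r_def)
qed

theorem theorem30:
  fixes b :: real and q r n :: nat
  assumes "b > 1"
    and "q = CARD('a::{field,finite})"
    and "n = CARD('n::finite)"
    and "2 \<le> r" and "r \<le> n"
  shows "log b (real (num_q_matroids (UNIV :: ('a^'n) set) r) + 1) \<le>
           1 / q_bracket q (n - r + 1) * real (gaussian_binomial (UNIV :: ('a^'n) set) r)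
             * log b (exp 1 * q_bracket q (n - r + 1)) * (1 + q_eps b q r n)"
proof -
  let ?E = "UNIV :: ('a^'n) set"
  have q: "q \<ge> 2" unfolding assms(2) by (rule card_field_ge_2)
  have dimE: "vec.dim ?E = n" using assms(3) by (simp add: vec.dim_UNIV card_cart_basis vec.dimension_def)
  \<comment> \<open>\<open>Suc d\<close> is the dimension of a complement of an (r-2)-space, on
    which the rank-two contractions live.\<close>
  define d where "d = n - r + 1"
  have d: "n - r + 2 = Suc d" "n - r + 1 = d" "d \<ge> 1" by (simp_all add: d_def)
  define x where "x = q_bracket q d"
  define z where "z = q_bracket q (Suc d)"
  define w where "w = q_bracket q 2"
  define N where "N = real (num_q_matroids ?E r) + 1"
  define G where "G = real (gaussian_binomial ?E r)"
  have pos: "x \<ge> 1" "z \<ge> 1" "w \<ge> 1"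
    using q_bracket_ge_1[OF q] d(3) by (simp_all add: x_def z_def w_def)
  have ex: "exp 1 * x > 1"
  proof -
    have "exp 1 * 1 \<le> exp 1 * x" using pos by (intro mult_left_mono) auto
    moreover have "exp (1::real) > 1" by simp
    ultimately show ?thesis by linarith
  qed
  have r: "2 + (r - 2) = r" using assms(4) by simp
  have "z * x / w * ln (real (num_q_matroids ?E (2 + (r - 2))) + 1)
      \<le> gaussian_binomial ?E (2 + (r - 2)) * ln (Suc d * rank2_bound q (Suc d))"
  proof (rule ln_num_q_matroids_le)
    fix C :: "('a^'n) set" assume C: "C \<in> subspaces_of ?E" "vec.dim C + (r - 2) = vec.dim ?E"
    have dC: "vec.dim C = Suc d" using C(2) dimE assms(4,5) by (simp add: d_def)
    have sC: "vec.subspace C" using C(1) by (rule subspaces_ofD)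
    have "real (num_q_matroids C 2) + 1 \<le> Suc d * rank2_bound q (Suc d)"
      using num_rank2_Suc_le[OF sC] d(3) unfolding dC assms(2) by simp
    moreover have "real (card {W \<in> subspaces_of C. vec.dim W = 2}) = z * x / w"
      using card_lines_q_bracket[OF sC dC] by (simp add: z_def x_def w_def assms(2))
    ultimately show "real (num_q_matroids C 2) + 1 \<le> Suc d * rank2_bound q (Suc d) \<and>
        real (card {W \<in> subspaces_of C. vec.dim W = 2}) = z * x / w" by blast
  qed (use dimE assms(4,5) in simp_all)
  then have main: "z * x / w * ln N \<le> G * ln (Suc d * rank2_bound q (Suc d))"
    unfolding r N_def G_def .
  have "ln (Suc d * rank2_bound q (Suc d)) = ln (Suc d) + z / w * ln (exp 1 * x)"
    using ex pos by (simp add: rank2_bound_def x_def[symmetric] z_def[symmetric] w_def[symmetric] ln_mult ln_powr)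
  with main have "z * x / w * ln N \<le> G * (ln (Suc d) + z / w * ln (exp 1 * x))" by simp
  \<comment> \<open>The multiplier is the reciprocal of the number of lines in dimension
    \<open>Suc d\<close>.\<close>
  then have "w / (z * x) * (z * x / w * ln N) \<le> w / (z * x) * (G * (ln (Suc d) + z / w * ln (exp 1 * x)))"
    using pos by (intro mult_left_mono) auto
  then have "ln N \<le> w / (z * x) * (G * (ln (Suc d) + z / w * ln (exp 1 * x)))"
    using pos by simp
  \<comment> \<open>Taking out the second summand as main term turns \<open>ln (Suc d)\<close> into
    the correction \<open>q_eps\<close>.\<close>
  also have "\<dots> = 1 / x * G * ln (exp 1 * x) * (1 + w * ln (Suc d) / (z * ln (exp 1 * x)))"
    using pos ln_gt_zero[OF ex] by (simp add: field_simps del: ln_exp)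
  finally have "ln N / ln b \<le> 1 / x * G * ln (exp 1 * x) * (1 + w * ln (Suc d) / (z * ln (exp 1 * x))) / ln b"
    using assms(1) by (intro divide_right_mono) auto
  \<comment> \<open>\<open>q_eps\<close> is a ratio of logarithms, so the base cancels.\<close>
  moreover have "q_eps b q r n = w * ln (Suc d) / (z * ln (exp 1 * x))"
    using assms(1) unfolding q_eps_def d log_def by (simp add: x_def z_def w_def)
  ultimately show ?thesis
    unfolding d log_def by (simp add: N_def G_def x_def)
qed

end
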